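(* Let $T$ be an interval exchange map of $d\ge 2$ intervals with admissible combinatorial data, with the Keane property, and with total length $\lambda^*=1$. If $T$ does not satisfy Condition (A), then $T$ does not satisfy Condition (D), where: Condition (A) says that for every $\varepsilon>0$ there is $C_\varepsilon>0$ such that $\|A(k,k+1)\|\le C_\varepsilon\|A(k)\|^{\varepsilon}$ for all $k\ge 1$; Condition (D) says that for every $\varepsilon>0$ there is $C_\varepsilon>0$ such that $\Delta(T^n)\ge C_\varepsilon\, n^{-(1+\varepsilon)}$ for all $n\ge 1$.
   Context: Interval exchange maps. Let $\mathcal A$ be an alphabet with $d\ge2$ letters. Combinatorial data is a pair $\pi=(\pi_t,\pi_b)$ of bijections $\mathcal A\to\{1,\dots,d\}$; it is admissible if $\pi_t^{-1}(\{1,\dots,k\})\ne\pi_b^{-1}(\{1,\dots,k\})$ for $k=1,\dots,d-1$. Length data is a vector $(\lambda_\alpha)_{\alpha\in\mathcal A}$ of positive reals; $\lambda^*=\sum_\alpha\lambda_\alpha$, $I=[0,\lambda^* )$, $p_\alpha=\sum_{\pi_t(\beta)<\pi_t(\alpha)}\lambda_\beta$, $I_\alpha=[p_\alpha,p_\alpha+\lambda_\alpha)$. The map is $T(x)=x+\sum_{\pi_b(\beta)<\pi_b(\alpha)}\lambda_\beta-\sum_{\pi_t(\beta)<\pi_t(\alpha)}\lambda_\beta$ for $x\in I_\alpha$. Keane property: there are no $\alpha,\beta\in\mathcal A$ and $m\ge1$ with $T^m(p_\alpha)=p_\beta$ and $\pi_t(\beta)>1$. Rauzy–Veech algorithm.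 Let $\alpha_t,\alpha_b$ be the letters with $\pi_t(\alpha_t)=\pi_b(\alpha_b)=d$. If $\lambda_{\alpha_t}>\lambda_{\alpha_b}$ (top type) the winner is $\alpha_t$ and the loser $\alpha_b$; the new data keep $\pi_t$, and in the order given by $\pi_b$ the letter $\alpha_b$ is moved to the position immediately after $\alpha_t$. If $\lambda_{\alpha_b}>\lambda_{\alpha_t}$ (bottom type) the winner is $\alpha_b$ and the loser $\alpha_t$; the new data keep $\pi_b$, and in the order given by $\pi_t$ the letter $\alpha_t$ is moved to the position immediately after $\alpha_b$. In both cases the winner's length is replaced by (winner's length minus loser's length) and all other lengths are kept. The new map $\mathcal V(T)$ is the first return map of $T$ to $[0,\sum_\alpha\hat\lambda_\alpha)$, where $\hat\lambda$ is the new length vector. For $T$ admissible with the Keane property this can be iterated forever; $T(n)=\mathcal V^n(T)$ has data $\pi^{(n)},\lambda(n)$ and total length $\lambda^*(n)$. Write $\gamma(m,n)$ for the sequence of steps (arrows) from $T(m)$ to $T(n)$. For a step with winner $\alpha$ and loser $\beta$ put $B=\mathbb I+E_{\beta\alpha}$ ($E_{\beta\alpha}$ has its only nonzero entry, a $1$, in row $\beta$, column $\alpha$); $Q(m,n)$ is the product of the matrices of the steps of $\gamma(m,n)$, later steps on the left, and $Q(n)=Q(0,n)$. The norm $\|\cdot\|$ of a matrix is the sum of the absolute values of its entries. Marmi–Moussa–Yoccoz acceleration. $m_0=0$ and $m_{k+1}>m_k$ is the largest integer such that not all letters of $\mathcal A$ are winners of steps in $\gamma(m_k,m_{k+1})$.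 $A(k)=Q(0,m_k)$, $A(k,\ell)=Q(m_k,m_\ell)$. Discontinuities. $D(T)=\{p_\alpha:\pi_t(\alpha)>1\}$, $D(T^n)=\bigcup_{i=0}^{n-1}T^{-i}(D(T))$, and $\Delta(T^n)$ is the minimum distance between distinct points of $D(T^n)\cup\{0,1\}$. *)

theory Defs
  imports "HOL-Analysis.Analysis"
begin

text \<open>The alphabet is a finite type, so the number of letters is \<open>d = CARD('a)\<close>.\<close>

record 'a iet =
  perm_t :: "'a \<Rightarrow> nat"
  perm_b :: "'a \<Rightarrow> nat"
  len :: "'a \<Rightarrow> real"

definition iet_data :: "'a::finite iet \<Rightarrow> bool" where
  "iet_data T \<longleftrightarrow>
     bij_betw (perm_t T) UNIV {1..CARD('a)} \<and>
     bij_betw (perm_b T) UNIV {1..CARD('a)} \<and>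
     (\<forall>\<alpha>. len T \<alpha> > 0)"

definition admissible :: "'a::finite iet \<Rightarrow> bool" where
  "admissible T \<longleftrightarrow>
     (\<forall>k. 1 \<le> k \<and> k < CARD('a) \<longrightarrow> perm_t T -` {1..k} \<noteq> perm_b T -` {1..k})"

definition total_length :: "'a::finite iet \<Rightarrow> real" where
  "total_length T = (\<Sum>\<alpha>\<in>UNIV. len T \<alpha>)"

definition dom_ival :: "'a::finite iet \<Rightarrow> real set" where
  "dom_ival T = {0..<total_length T}"

definition left_t :: "'a::finite iet \<Rightarrow> 'a \<Rightarrow> real" where
  "left_t T \<alpha> = (\<Sum>\<beta> | perm_t T \<beta> < perm_t T \<alpha>. len T \<beta>)"

definition left_b :: "'a::finite iet \<Rightarrow> 'a \<Rightarrow> real" where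
  "left_b T \<alpha> = (\<Sum>\<beta> | perm_b T \<beta> < perm_b T \<alpha>. len T \<beta>)"

definition sub_ival :: "'a::finite iet \<Rightarrow> 'a \<Rightarrow> real set" where
  "sub_ival T \<alpha> = {left_t T \<alpha>..<left_t T \<alpha> + len T \<alpha>}"

text \<open>For \<open>iet_data T\<close> the intervals \<open>sub_ival T \<alpha>\<close> partition \<open>dom_ival T\<close>; the map is
  extended by the identity outside \<open>dom_ival T\<close>, and these values are never used.\<close>

definition iet_map :: "'a::finite iet \<Rightarrow> real \<Rightarrow> real" where
  "iet_map T x =
     (if x \<in> dom_ival T
      then (let \<alpha> = (THE \<alpha>. x \<in> sub_ival T \<alpha>) in x + left_b T \<alpha> - left_t T \<alpha>)
      else x)"

definition keane :: "'a::finite iet \<Rightarrow> bool" where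
  "keane T \<longleftrightarrow>
     \<not> (\<exists>\<alpha> \<beta>. \<exists>m\<ge>1. (iet_map T ^^ m) (left_t T \<alpha>) = left_t T \<beta> \<and> perm_t T \<beta> > 1)"

definition last_t :: "'a::finite iet \<Rightarrow> 'a" where
  "last_t T = (THE \<alpha>. perm_t T \<alpha> = CARD('a))"

definition last_b :: "'a::finite iet \<Rightarrow> 'a" where
  "last_b T = (THE \<alpha>. perm_b T \<alpha> = CARD('a))"

text \<open>The algorithm is undefined when the two last letters have equal lengths. This never
  occurs along the orbit of admissible data with the Keane property, so the case is merged
  with the bottom type below.\<close>

definition top_type :: "'a::finite iet \<Rightarrow> bool" where
  "top_type T \<longleftrightarrow> len T (last_t T) > len T (last_b T)"

definition winner :: "'a::finite iet \<Rightarrow> 'a" where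
  "winner T = (if top_type T then last_t T else last_b T)"

definition loser :: "'a::finite iet \<Rightarrow> 'a" where
  "loser T = (if top_type T then last_b T else last_t T)"

text \<open>In the ranking \<open>p\<close>, in which \<open>l\<close> comes last, move \<open>l\<close> to the position immediately
  after \<open>w\<close>.\<close>

definition move_after :: "'a \<Rightarrow> 'a \<Rightarrow> ('a \<Rightarrow> nat) \<Rightarrow> 'a \<Rightarrow> nat" where
  "move_after l w p = (\<lambda>\<beta>. if \<beta> = l then p w + 1
                           else if p \<beta> \<le> p w then p \<beta>
                           else p \<beta> + 1)"

text \<open>The resulting data represent the first return map of \<open>iet_map T\<close> to the interval
  \<open>[0, \<lambda>*)\<close> whose length \<open>\<lambda>*\<close> is the new total length.\<close>

definition rauzy_veech :: "'a::finite iet \<Rightarrow> 'a iet" where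
  "rauzy_veech T =
     \<lparr> perm_t = (if top_type T then perm_t T
                 else move_after (loser T) (winner T) (perm_t T)),
       perm_b = (if top_type T then move_after (loser T) (winner T) (perm_b T)
                 else perm_b T),
       len = (len T)(winner T := len T (winner T) - len T (loser T)) \<rparr>"

definition rv_iter :: "'a::finite iet \<Rightarrow> nat \<Rightarrow> 'a iet" where
  "rv_iter T n = (rauzy_veech ^^ n) T"

definition step_matrix :: "'a::finite iet \<Rightarrow> real^'a^'a" where
  "step_matrix T = mat 1 + (\<chi> i j. if i = loser T \<and> j = winner T then 1 else 0)"

text \<open>\<open>rv_matrix T m n\<close> is \<open>Q(m,n)\<close>, meaningful for \<open>m \<le> n\<close>; step number \<open>j\<close> leads from
  \<open>rv_iter T j\<close> to \<open>rv_iter T (j + 1)\<close>.\<close>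

fun rv_matrix :: "'a::finite iet \<Rightarrow> nat \<Rightarrow> nat \<Rightarrow> real^'a^'a" where
  "rv_matrix T m 0 = mat 1"
| "rv_matrix T m (Suc n) =
     (if m \<le> n then step_matrix (rv_iter T n) ** rv_matrix T m n else mat 1)"

definition winners :: "'a::finite iet \<Rightarrow> nat \<Rightarrow> nat \<Rightarrow> 'a set" where
  "winners T m n = (\<lambda>j. winner (rv_iter T j)) ` {m..<n}"

text \<open>The accelerated times \<open>m\<^sub>k\<close>. For \<open>d \<ge> 2\<close>, admissible data and the Keane property the
  maximum exists, since every letter wins infinitely often.\<close>

primrec mmy_time :: "'a::finite iet \<Rightarrow> nat \<Rightarrow> nat" where
  "mmy_time T 0 = 0"
| "mmy_time T (Suc k) =
     (GREATEST m. m > mmy_time T k \<and> winners T (mmy_time T k) m \<noteq> UNIV)"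

definition mmy_matrix :: "'a::finite iet \<Rightarrow> nat \<Rightarrow> nat \<Rightarrow> real^'a^'a" where
  "mmy_matrix T k l = rv_matrix T (mmy_time T k) (mmy_time T l)"

definition matrix_norm1 :: "real^'n^'m \<Rightarrow> real" where
  "matrix_norm1 M = (\<Sum>i\<in>UNIV. \<Sum>j\<in>UNIV. \<bar>M $ i $ j\<bar>)"

definition condition_A :: "'a::finite iet \<Rightarrow> bool" where
  "condition_A T \<longleftrightarrow>
     (\<forall>\<epsilon>>0. \<exists>C>0. \<forall>k\<ge>1.
        matrix_norm1 (mmy_matrix T k (k + 1)) \<le> C * matrix_norm1 (mmy_matrix T 0 k) powr \<epsilon>)"

definition discont :: "'a::finite iet \<Rightarrow> real set" where
  "discont T = left_t T ` {\<alpha>. perm_t T \<alpha> > 1}"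

definition discont_pow :: "'a::finite iet \<Rightarrow> nat \<Rightarrow> real set" where
  "discont_pow T n = (\<Union>i<n. {x \<in> dom_ival T. (iet_map T ^^ i) x \<in> discont T})"

text \<open>The minimal spacing is only used for maps of total length \<open>1\<close>, hence the end points
  \<open>0\<close> and \<open>1\<close>.\<close>

definition min_spacing :: "'a::finite iet \<Rightarrow> nat \<Rightarrow> real" where
  "min_spacing T n =
     Min {\<bar>x - y\<bar> | x y. x \<in> discont_pow T n \<union> {0, 1} \<and> y \<in> discont_pow T n \<union> {0, 1} \<and> x \<noteq> y}"

definition condition_D :: "'a::finite iet \<Rightarrow> bool" where
  "condition_D T \<longleftrightarrow>
     (\<forall>\<epsilon>>0. \<exists>C>0. \<forall>n\<ge>1. min_spacing T n \<ge> C * real n powr (- (1 + \<epsilon>)))"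

end

theory Submission imports Defs begin

text \<open>Write \<open>r\<^sub>\<alpha>(n)\<close> for the return time of the interval \<open>\<alpha>\<close> of \<open>T(n)\<close>, so that
  \<open>N(n) = \<parallel>Q(n)\<parallel>\<close> is the sum of the return times and \<open>\<Sum>\<^sub>\<alpha> \<lambda>\<^sub>\<alpha>(n) r\<^sub>\<alpha>(n) = 1\<close>. The length
  \<open>\<lambda>\<^sub>\<alpha>(n)\<close> is at least the distance of two points of \<open>D(T\<^sup>M) \<union> {0, 1}\<close> with \<open>M = 2 N(n)\<close>, so
  Condition (D) bounds it from below by \<open>N(n)\<close> to a power slightly below \<open>-1\<close>. The length of
  a letter that does not win between times \<open>s\<close> and \<open>n\<close> does not change, hence its return time at
  time \<open>n\<close> is at most \<open>N(s)\<close> to a power slightly above \<open>1\<close>.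

  This bound extends to all of \<open>N(n)\<close> by induction on the number of winners between \<open>s\<close> and \<open>n\<close>.
  If a proper set \<open>W\<close> of letters wins several times over, admissibility forces a letter outside \<open>W\<close>
  to lose against some letter of \<open>W\<close>, whose return time was thus small before that step. As a
  winner that does not win the next step loses it, smallness spreads to all letters of \<open>W\<close> further
  back in time. Dually, after boundedly many accelerated steps every return time dominates all
  those at the beginning, so a bound for \<open>\<parallel>A(k + 1)\<parallel>\<close> yields one for \<open>\<parallel>A(k, k + 1)\<parallel>\<close>.\<close>

subsection \<open>Offsets\<close>

text \<open>\<open>left_t\<close> and \<open>left_b\<close> both have this form, one for each row,
  so the two types of step can share their computations.\<close>

definition offset :: "('a::finite \<Rightarrow> nat) \<Rightarrow> ('a \<Rightarrow> real) \<Rightarrow> 'a \<Rightarrow> real" where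
  "offset p l \<alpha> = (\<Sum>\<beta> | p \<beta> < p \<alpha>. l \<beta>)"

lemma left_t_offset: "left_t T = offset (perm_t T) (len T)"
  by (simp add: left_t_def offset_def fun_eq_iff)

lemma left_b_offset: "left_b T = offset (perm_b T) (len T)"
  by (simp add: left_b_def offset_def fun_eq_iff)

lemma offset_update_last:
  assumes "\<And>\<beta>. p \<beta> \<le> p w"
  shows "offset p (l(w := c)) \<beta> = offset p l \<beta>"
proof -
  have "\<gamma> \<noteq> w" if "p \<gamma> < p \<beta>" for \<gamma>
    using that assms[of \<beta>] by auto
  then show ?thesis
    unfolding offset_def by (intro sum.cong) auto
qed

lemma offset_add_len:
  assumes "inj p"
  shows "offset p l w + l w = (\<Sum>\<beta> | p \<beta> \<le> p w. l \<beta>)"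
proof -
  have "{\<beta>. p \<beta> \<le> p w} = insert w {\<beta>. p \<beta> < p w}"
    using assms by (auto simp: le_less dest: injD)
  then show ?thesis by (simp add: offset_def)
qed

lemma offset_last:
  assumes "inj p" "\<And>\<beta>. p \<beta> \<le> p w"
  shows "offset p l w + l w = sum l UNIV"
  using offset_add_len[OF assms(1), of l w] assms(2) by simp

lemma offset_next:
  assumes "inj p" "p w' = Suc (p w)"
  shows "offset p l w' = offset p l w + l w"
  unfolding offset_add_len[OF assms(1)] by (simp add: offset_def assms(2) less_Suc_eq_le)

text \<open>Letters beyond \<open>w\<close> gain \<open>a\<close> on their left, but
  \<open>w\<close> has become shorter by \<open>l a\<close>, and the two changes cancel. Only
  \<open>a\<close> itself shifts, to the end of the shortened \<open>w\<close>.\<close>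

lemma offset_move_after:
  assumes inj: "inj p" and max: "\<And>\<beta>. p \<beta> \<le> p a" and wa: "w \<noteq> a"
  shows "offset (move_after a w p) (l(w := l w - l a)) \<beta> =
    (if \<beta> = a then offset p l w + l w - l a else offset p l \<beta>)"
proof -
  let ?p = "move_after a w p" and ?l = "l(w := l w - l a)"
  have lt: "p \<gamma> < p a" if "\<gamma> \<noteq> a" for \<gamma>
    using max[of \<gamma>] that inj by (metis injD le_neq_implies_less)
  consider "\<beta> = a" | "\<beta> \<noteq> a" "p \<beta> \<le> p w" | "\<beta> \<noteq> a" "p \<beta> > p w" by force
  then show ?thesis
  proof cases
    case 1
    have "{\<gamma>. ?p \<gamma> < ?p \<beta>} = {\<gamma>. p \<gamma> \<le> p w}"
      using 1 lt[OF wa] by (auto simp: move_after_def split: if_splits)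
    moreover have "{\<gamma>. p \<gamma> \<le> p w} = insert w {\<gamma>. p \<gamma> < p w}"
      using inj by (auto simp: le_less dest: injD)
    moreover have "sum ?l {\<gamma>. p \<gamma> < p w} = sum l {\<gamma>. p \<gamma> < p w}"
      by (intro sum.cong) auto
    ultimately show ?thesis using 1 by (simp add: offset_def)
  next
    case 2
    have "{\<gamma>. ?p \<gamma> < ?p \<beta>} = {\<gamma>. p \<gamma> < p \<beta>}"
      using 2 max[of \<beta>] lt[of \<beta>] by (auto simp: move_after_def split: if_splits)
    moreover have "sum ?l {\<gamma>. p \<gamma> < p \<beta>} = sum l {\<gamma>. p \<gamma> < p \<beta>}"
      using 2 by (intro sum.cong) auto
    ultimately show ?thesis using 2 by (simp add: offset_def)
  next
    case 3
    let ?A = "{\<gamma>. p \<gamma> < p \<beta>}"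
    have "{\<gamma>. ?p \<gamma> < ?p \<beta>} = insert a ?A"
      using 3 lt[of \<beta>] by (auto simp: move_after_def split: if_splits)
    moreover have "a \<notin> ?A" using max[of \<beta>] by simp
    moreover have "sum ?l ?A = sum l ?A - l a"
    proof -
      have "w \<in> ?A" using 3 by simp
      then show ?thesis
        by (simp add: sum.remove[of ?A w] sum.remove[of ?A w l])
    qed
    ultimately show ?thesis using 3 wa by (simp add: offset_def)
  qed
qed

lemma offset_mono:
  assumes "inj p" "\<And>\<gamma>. l \<gamma> \<ge> 0" "p \<alpha> < p \<beta>"
  shows "offset p l \<alpha> + l \<alpha> \<le> offset p l \<beta>"
  unfolding offset_add_len[OF assms(1)] unfolding offset_def
  using assms by (intro sum_mono2) auto

lemma offset_le_sum:
  assumes "inj p" "\<And>\<gamma>. l \<gamma> \<ge> 0"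
  shows "offset p l \<alpha> + l \<alpha> \<le> sum l UNIV"
  unfolding offset_add_len[OF assms(1)]
  using assms by (intro sum_mono2) auto

lemma offset_nonneg:
  assumes "\<And>\<gamma>. l \<gamma> \<ge> 0"
  shows "offset p l \<alpha> \<ge> 0"
  unfolding offset_def using assms by (intro sum_nonneg) auto

section \<open>Moving a letter preserves the combinatorial data\<close>

lemma inj_move_after:
  assumes inj: "inj p" and wa: "w \<noteq> a"
  shows "inj (move_after a w p)"
proof (rule injI)
  fix x y assume "move_after a w p x = move_after a w p y"
  then show "x = y"
    using inj wa by (auto simp: move_after_def dest: injD split: if_splits)
qed

lemma bij_move_after:
  fixes p :: "'a::finite \<Rightarrow> nat"
  assumes bij: "bij_betw p UNIV {1..CARD('a)}" and a: "p a = CARD('a)" and wa: "w \<noteq> a"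
  shows "bij_betw (move_after a w p) UNIV {1..CARD('a)}"
proof -
  have inj: "inj p" and range: "range p = {1..CARD('a)}"
    using bij by (auto simp: bij_betw_def)
  have le: "1 \<le> p \<beta>" "p \<beta> \<le> p a" for \<beta> using range a by auto
  have lt: "p \<gamma> < CARD('a)" if "\<gamma> \<noteq> a" for \<gamma>
    using le[of \<gamma>] that inj a by (metis injD le_neq_implies_less)
  have "range (move_after a w p) \<subseteq> {1..CARD('a)}"
    using le lt wa a by (auto simp: move_after_def Suc_le_eq)
  moreover have "inj (move_after a w p)" using inj wa by (rule inj_move_after)
  ultimately show ?thesis
    by (metis bij_betw_def card_atLeastAtMost card_image card_subset_eq diff_Suc_1 finite_atLeastAtMost)
qed

text \<open>A move alters nothing up to the position of \<open>w\<close>, so an initial segment that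
  misses \<open>w\<close> afterwards is the same as before. This carries admissibility over.\<close>

lemma vimage_move_after:
  assumes max: "\<And>\<beta>. p \<beta> \<le> p a" and w: "w \<notin> move_after a w p -` {1..k}"
    and wa: "w \<noteq> a" and pos: "p w \<ge> 1"
  shows "move_after a w p -` {1..k} = p -` {1..k}"
proof -
  have "p w > k" using w wa pos by (auto simp: move_after_def)
  then show ?thesis using max[of w] by (auto simp: move_after_def split: if_splits)
qed

section \<open>Intervals, branches and discontinuities of a single interval exchange\<close>

context
  fixes S :: "'a::finite iet"
  assumes data: "iet_data S"
begin

lemma bij_perm: "bij_betw (perm_t S) UNIV {1..CARD('a)}" "bij_betw (perm_b S) UNIV {1..CARD('a)}"
  using data by (auto simp: iet_data_def)

lemma inj_perm: "inj (perm_t S)" "inj (perm_b S)"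
  using bij_perm by (auto simp: bij_betw_def)

lemma perm_le: "perm_t S \<alpha> \<le> CARD('a)" "perm_b S \<alpha> \<le> CARD('a)"
  and perm_ge: "1 \<le> perm_t S \<alpha>" "1 \<le> perm_b S \<alpha>"
  using bij_perm[THEN bij_betwE] by auto

lemma len_pos: "len S \<alpha> > 0" and len_nonneg: "len S \<alpha> \<ge> 0"
  using data by (auto simp: iet_data_def less_imp_le)

lemma ex_perm:
  assumes "1 \<le> k" "k \<le> CARD('a)"
  shows "\<exists>\<alpha>. perm_t S \<alpha> = k" "\<exists>\<alpha>. perm_b S \<alpha> = k"
proof -
  have "k \<in> perm_t S ` UNIV" "k \<in> perm_b S ` UNIV"
    using assms bij_perm by (simp_all add: bij_betw_def)
  then show "\<exists>\<alpha>. perm_t S \<alpha> = k" "\<exists>\<alpha>. perm_b S \<alpha> = k" by auto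
qed

lemma perm_last: "perm_t S (last_t S) = CARD('a)" "perm_b S (last_b S) = CARD('a)"
proof -
  have d: "1 \<le> CARD('a)" by (simp add: Suc_le_eq)
  have "\<exists>!\<alpha>. perm_t S \<alpha> = CARD('a)" "\<exists>!\<alpha>. perm_b S \<alpha> = CARD('a)"
    using ex_perm[OF d] inj_perm by (metis injD order_refl)+
  from this[THEN theI'] show "perm_t S (last_t S) = CARD('a)" "perm_b S (last_b S) = CARD('a)"
    unfolding last_t_def last_b_def by simp_all
qed

lemma last_tI: "perm_t S \<alpha> = CARD('a) \<Longrightarrow> last_t S = \<alpha>"
  and last_bI: "perm_b S \<alpha> = CARD('a) \<Longrightarrow> last_b S = \<alpha>"
  using perm_last inj_perm by (metis injD)+

lemma perm_le_last: "perm_t S \<alpha> \<le> perm_t S (last_t S)" "perm_b S \<alpha> \<le> perm_b S (last_b S)"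
  by (simp_all add: perm_last perm_le)

lemma left_t_last: "left_t S (last_t S) + len S (last_t S) = total_length S"
  and left_b_last: "left_b S (last_b S) + len S (last_b S) = total_length S"
  unfolding left_t_offset left_b_offset total_length_def
  using inj_perm perm_le_last by (intro offset_last; simp)+

lemma sub_ival_subset: "sub_ival S \<alpha> \<subseteq> dom_ival S"
  using offset_le_sum[of "perm_t S" "len S" \<alpha>] offset_nonneg[of "len S" "perm_t S" \<alpha>] inj_perm len_nonneg
  by (auto simp: sub_ival_def dom_ival_def left_t_offset total_length_def)

lemma sub_ival_unique:
  assumes "x \<in> sub_ival S \<alpha>" "x \<in> sub_ival S \<beta>"
  shows "\<alpha> = \<beta>"
proof (rule ccontr)
  assume "\<alpha> \<noteq> \<beta>"
  then have "perm_t S \<alpha> < perm_t S \<beta> \<or> perm_t S \<beta> < perm_t S \<alpha>"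
    using inj_perm by (metis injD linorder_neqE_nat)
  then show False
    using assms offset_mono[of "perm_t S" "len S"] inj_perm len_nonneg
    by (fastforce simp: sub_ival_def left_t_offset)
qed

lemma iet_map_sub_ival:
  assumes "x \<in> sub_ival S \<alpha>"
  shows "iet_map S x = x + left_b S \<alpha> - left_t S \<alpha>"
proof -
  have "(THE \<alpha>. x \<in> sub_ival S \<alpha>) = \<alpha>"
    using assms sub_ival_unique by blast
  then show ?thesis using assms sub_ival_subset by (auto simp: iet_map_def Let_def)
qed

lemma left_t_in_sub_ival: "left_t S \<alpha> \<in> sub_ival S \<alpha>"
  using len_pos by (simp add: sub_ival_def)

lemma left_t_first: "perm_t S \<alpha> = 1 \<Longrightarrow> left_t S \<alpha> = 0"
proof -
  assume "perm_t S \<alpha> = 1"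
  then have "{\<beta>. perm_t S \<beta> < perm_t S \<alpha>} = {}"
    using perm_ge(1) by (auto simp: not_less Suc_le_eq)
  then show "left_t S \<alpha> = 0" unfolding left_t_def by simp
qed

lemma sub_ival_cover:
  assumes "x \<in> dom_ival S"
  shows "\<exists>\<alpha>. x \<in> sub_ival S \<alpha>"
proof -
  let ?A = "{k \<in> {1..CARD('a)}. \<exists>\<alpha>. perm_t S \<alpha> = k \<and> left_t S \<alpha> \<le> x}"
  have x: "0 \<le> x" "x < total_length S" using assms by (auto simp: dom_ival_def)
  obtain \<alpha>0 where "perm_t S \<alpha>0 = 1" using ex_perm(1)[of 1] by (auto simp: Suc_le_eq)
  then have "perm_t S \<alpha>0 \<in> ?A" using left_t_first[of \<alpha>0] x perm_le perm_ge by auto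
  then have "Max ?A \<in> ?A" by (intro Max_in) auto
  then obtain \<alpha> where \<alpha>: "perm_t S \<alpha> = Max ?A" "left_t S \<alpha> \<le> x" by auto
  have "x < left_t S \<alpha> + len S \<alpha>"
  proof (cases "perm_t S \<alpha> = CARD('a)")
    case True
    then show ?thesis using left_t_last x last_tI by auto
  next
    case False
    then have "Suc (perm_t S \<alpha>) \<le> CARD('a)" using perm_le(1)[of \<alpha>] by simp
    then obtain \<beta> where \<beta>: "perm_t S \<beta> = Suc (perm_t S \<alpha>)" using ex_perm(1) by fastforce
    have "\<not> left_t S \<beta> \<le> x"
    proof
      assume "left_t S \<beta> \<le> x"
      then have "perm_t S \<beta> \<in> ?A" using perm_le perm_ge by auto
      then have "perm_t S \<beta> \<le> Max ?A" by (intro Max_ge) auto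
      then show False using \<alpha> \<beta> by simp
    qed
    then show ?thesis using offset_next[OF inj_perm(1) \<beta>, of "len S"] by (simp add: left_t_offset)
  qed
  then show ?thesis using \<alpha> by (auto simp: sub_ival_def)
qed

lemma iet_map_dom: 
  assumes "x \<in> dom_ival S"
  shows "iet_map S x \<in> dom_ival S"
proof -
  obtain \<alpha> where \<alpha>: "x \<in> sub_ival S \<alpha>" using sub_ival_cover assms by blast
  show ?thesis
    using \<alpha> offset_le_sum[of "perm_b S" "len S" \<alpha>] offset_nonneg[of "len S" "perm_b S" \<alpha>]
      inj_perm len_nonneg
    by (auto simp: iet_map_sub_ival sub_ival_def dom_ival_def left_b_offset total_length_def)
qed

text \<open>Each branch is a translation, so one more preimage is covered by finitely many
  translates of the previous one. Finiteness makes the \<open>Min\<close> in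
  \<open>min_spacing\<close> a true minimum.\<close>

lemma finite_iet_map_preimage:
  assumes "finite F"
  shows "finite {x \<in> dom_ival S. (iet_map S ^^ i) x \<in> F}"
proof (induction i)
  case 0
  then show ?case using assms by (auto intro: finite_subset)
next
  case (Suc i)
  let ?P = "{x \<in> dom_ival S. (iet_map S ^^ i) x \<in> F}"
  have "{x \<in> dom_ival S. (iet_map S ^^ Suc i) x \<in> F} \<subseteq>
      (\<Union>\<alpha>. (\<lambda>y. y - left_b S \<alpha> + left_t S \<alpha>) ` ?P)"
  proof
    fix x assume x: "x \<in> {x \<in> dom_ival S. (iet_map S ^^ Suc i) x \<in> F}"
    then obtain \<alpha> where "x \<in> sub_ival S \<alpha>" using sub_ival_cover by blast
    then have "x = iet_map S x - left_b S \<alpha> + left_t S \<alpha>" by (simp add: iet_map_sub_ival)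
    moreover have "iet_map S x \<in> ?P"
      using x iet_map_dom by (auto simp: funpow_swap1)
    ultimately show "x \<in> (\<Union>\<alpha>. (\<lambda>y. y - left_b S \<alpha> + left_t S \<alpha>) ` ?P)" by blast
  qed
  then show ?case using Suc by (auto intro: finite_subset)
qed

lemma finite_discont_pow: "finite (discont_pow S n)"
  unfolding discont_pow_def
  by (intro finite_UN_I finite_iet_map_preimage) (auto simp: discont_def)

lemma min_spacing_le:
  assumes "x \<in> discont_pow S n \<union> {0, 1}" "y \<in> discont_pow S n \<union> {0, 1}" "x \<noteq> y"
  shows "min_spacing S n \<le> \<bar>x - y\<bar>"
proof -
  let ?D = "discont_pow S n \<union> {0, 1}"
  have "{\<bar>x - y\<bar> | x y. x \<in> ?D \<and> y \<in> ?D \<and> x \<noteq> y} \<subseteq> (\<lambda>(x, y). \<bar>x - y\<bar>) ` (?D \<times> ?D)"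
    by auto
  moreover have "finite ((\<lambda>(x, y). \<bar>x - y\<bar>) ` (?D \<times> ?D))"
    using finite_discont_pow by simp
  ultimately have "finite {\<bar>x - y\<bar> | x y. x \<in> ?D \<and> y \<in> ?D \<and> x \<noteq> y}"
    by (rule finite_subset)
  then show ?thesis unfolding min_spacing_def using assms by (intro Min_le) auto
qed

end

subsection \<open>One step of the algorithm\<close>

context
  fixes S :: "'a::finite iet"
  assumes data: "iet_data S" and adm: "admissible S" and two: "CARD('a) \<ge> 2"
begin

text \<open>A common last letter would leave the same letters in the first
  \<open>CARD('a) - 1\<close> places of both rows, against admissibility.\<close>

lemma last_neq: "last_t S \<noteq> last_b S"
proof
  assume eq: "last_t S = last_b S"
  have last: "perm_t S \<beta> = CARD('a) \<longleftrightarrow> \<beta> = last_t S" "perm_b S \<beta> = CARD('a) \<longleftrightarrow> \<beta> = last_b S" for \<beta>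
    using perm_last[OF data] last_tI[OF data] last_bI[OF data] by blast+
  have "perm_t S \<beta> \<in> {1..CARD('a) - 1} \<longleftrightarrow> \<beta> \<noteq> last_t S"
       "perm_b S \<beta> \<in> {1..CARD('a) - 1} \<longleftrightarrow> \<beta> \<noteq> last_b S" for \<beta>
    using perm_le[OF data, of \<beta>] perm_ge[OF data, of \<beta>] last[of \<beta>] two
    unfolding atLeastAtMost_iff by linarith+
  then have "perm_t S -` {1..CARD('a) - 1} = perm_b S -` {1..CARD('a) - 1}"
    using eq by (auto simp del: atLeastAtMost_iff)
  then show False using adm two by (auto simp: admissible_def)
qed

lemma winner_neq_loser: "winner S \<noteq> loser S"
  using last_neq by (auto simp: winner_def loser_def)

lemma rauzy_veech_top:
  assumes "top_type S"
  shows "winner S = last_t S" "loser S = last_b S"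
    "perm_t (rauzy_veech S) = perm_t S"
    "perm_b (rauzy_veech S) = move_after (last_b S) (last_t S) (perm_b S)"
    "len (rauzy_veech S) = (len S)(last_t S := len S (last_t S) - len S (last_b S))"
  using assms by (simp_all add: rauzy_veech_def winner_def loser_def)

lemma rauzy_veech_bottom:
  assumes "\<not> top_type S"
  shows "winner S = last_b S" "loser S = last_t S"
    "perm_b (rauzy_veech S) = perm_b S"
    "perm_t (rauzy_veech S) = move_after (last_t S) (last_b S) (perm_t S)"
    "len (rauzy_veech S) = (len S)(last_b S := len S (last_b S) - len S (last_t S))"
  using assms by (simp_all add: rauzy_veech_def winner_def loser_def)

text \<open>Equal initial segments after the step cannot contain the winner, which is still last in
  the row that is kept. Then the segment of the changed row is the old one too, so the equality held
  before the step.\<close>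

lemma admissible_rauzy_veech: "admissible (rauzy_veech S)"
  unfolding admissible_def
proof (intro allI impI)
  fix k assume k: "1 \<le> k \<and> k < CARD('a)"
  note facts = perm_last[OF data] perm_ge[OF data] perm_le_last[OF data] last_neq
  show "perm_t (rauzy_veech S) -` {1..k} \<noteq> perm_b (rauzy_veech S) -` {1..k}" (is "?t \<noteq> ?b")
  proof
    assume eq: "?t = ?b"
    show False
    proof (cases "top_type S")
      case True
      note rv = rauzy_veech_top[OF True]
      have "last_t S \<notin> ?t" using k facts by (simp add: rv)
      then have "last_t S \<notin> ?b" unfolding eq .
      then have "?b = perm_b S -` {1..k}"
        unfolding rv using facts by (intro vimage_move_after) auto
      then show False using eq adm k by (auto simp: admissible_def rv)
    next
      case False
      note rv = rauzy_veech_bottom[OF False]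
      have "last_b S \<notin> ?b" using k facts by (simp add: rv)
      then have "last_b S \<notin> ?t" unfolding eq .
      then have "?t = perm_t S -` {1..k}"
        unfolding rv using facts by (intro vimage_move_after) auto
      then show False using eq adm k by (auto simp: admissible_def rv)
    qed
  qed
qed

lemma iet_data_rauzy_veech:
  assumes "len S (last_t S) \<noteq> len S (last_b S)"
  shows "iet_data (rauzy_veech S)"
proof -
  have "bij_betw (move_after (last_b S) (last_t S) (perm_b S)) UNIV {1..CARD('a)}"
    "bij_betw (move_after (last_t S) (last_b S) (perm_t S)) UNIV {1..CARD('a)}"
    using bij_perm[OF data] last_neq perm_last[OF data] by (intro bij_move_after; simp)+
  then show ?thesis
    using bij_perm[OF data] len_pos[OF data] assms
    by (cases "top_type S")
      (auto simp: iet_data_def rauzy_veech_top rauzy_veech_bottom top_type_def)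
qed

lemma left_rauzy_veech_top:
  assumes "top_type S"
  shows "left_t (rauzy_veech S) \<beta> = left_t S \<beta>"
    "left_b (rauzy_veech S) \<beta> = (if \<beta> = last_b S
       then left_b S (last_t S) + len S (last_t S) - len S (last_b S) else left_b S \<beta>)"
  unfolding left_t_offset left_b_offset rauzy_veech_top[OF assms]
  using perm_le_last[OF data] inj_perm[OF data] last_neq
  by (intro offset_update_last offset_move_after; simp)+

lemma left_rauzy_veech_bottom:
  assumes "\<not> top_type S"
  shows "left_b (rauzy_veech S) \<beta> = left_b S \<beta>"
    "left_t (rauzy_veech S) \<beta> = (if \<beta> = last_t S
       then left_t S (last_b S) + len S (last_b S) - len S (last_t S) else left_t S \<beta>)"
  unfolding left_t_offset left_b_offset rauzy_veech_bottom[OF assms]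
  using perm_le_last[OF data] inj_perm[OF data] last_neq
  by (intro offset_update_last offset_move_after; simp)+

lemma iet_map_rauzy_veech_other:
  assumes data': "iet_data (rauzy_veech S)" and x: "x \<in> sub_ival (rauzy_veech S) \<alpha>" and "\<alpha> \<noteq> loser S"
  shows "x \<in> sub_ival S \<alpha>" "iet_map (rauzy_veech S) x = iet_map S x"
proof -
  show *: "x \<in> sub_ival S \<alpha>"
    using x assms(3) len_pos[OF data, of "last_t S"] len_pos[OF data, of "last_b S"]
    by (cases "top_type S")
      (simp_all add: sub_ival_def rauzy_veech_top left_rauzy_veech_top rauzy_veech_bottom
        left_rauzy_veech_bottom split: if_splits)
  show "iet_map (rauzy_veech S) x = iet_map S x"
    using assms(3)
    by (cases "top_type S")
      (simp_all add: iet_map_sub_ival[OF data' x] iet_map_sub_ival[OF data *] rauzy_veech_top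
        left_rauzy_veech_top rauzy_veech_bottom left_rauzy_veech_bottom)
qed

text \<open>For either type the point runs through the interval of \<open>last_b\<close> first and
  then through that of \<open>last_t\<close>. Which of them is the loser depends on the type, so the
  pair is left unordered.\<close>

lemma iet_map_rauzy_veech_loser:
  assumes data': "iet_data (rauzy_veech S)" and x: "x \<in> sub_ival (rauzy_veech S) (loser S)"
  obtains \<alpha> \<beta> where "{\<alpha>, \<beta>} = {loser S, winner S}" "\<alpha> \<noteq> \<beta>" "x \<in> sub_ival S \<alpha>"
    "iet_map S x \<in> sub_ival S \<beta>" "iet_map (rauzy_veech S) x = iet_map S (iet_map S x)"
proof (cases "top_type S")
  case True
  note rv = rauzy_veech_top[OF True] left_rauzy_veech_top[OF True]
  have 1: "x \<in> sub_ival S (last_b S)" using x last_neq by (auto simp: sub_ival_def rv)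
  \<comment> \<open>The image of the bottom-last interval ends at the total length, where the longer
    top-last interval ends as well.\<close>
  have 2: "iet_map S x \<in> sub_ival S (last_t S)"
    using 1 left_b_last[OF data] left_t_last[OF data] True
    by (simp add: iet_map_sub_ival[OF data 1]) (auto simp: sub_ival_def top_type_def)
  have "iet_map (rauzy_veech S) x = iet_map S (iet_map S x)"
    using left_b_last[OF data] left_t_last[OF data] iet_map_sub_ival[OF data 2]
      iet_map_sub_ival[OF data 1] iet_map_sub_ival[OF data' x]
    by (simp add: rv)
  with 1 2 that[of "last_b S" "last_t S"] last_neq show ?thesis by (auto simp: rv)
next
  case False
  note rv = rauzy_veech_bottom[OF False] left_rauzy_veech_bottom[OF False]
  have 1: "x \<in> sub_ival S (last_b S)"
    using x last_neq False by (auto simp: sub_ival_def rv top_type_def)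
  have 2: "iet_map S x \<in> sub_ival S (last_t S)"
    using x left_b_last[OF data] left_t_last[OF data] last_neq
    by (simp add: iet_map_sub_ival[OF data 1]) (auto simp: sub_ival_def rv)
  have "iet_map (rauzy_veech S) x = iet_map S (iet_map S x)"
    using left_b_last[OF data] left_t_last[OF data] iet_map_sub_ival[OF data 2]
      iet_map_sub_ival[OF data 1] iet_map_sub_ival[OF data' x]
    by (simp add: rv)
  with 1 2 that[of "last_b S" "last_t S"] last_neq show ?thesis by (auto simp: rv)
qed

lemma winner_last_rauzy_veech:
  assumes data': "iet_data (rauzy_veech S)"
  shows "winner S \<in> {last_t (rauzy_veech S), last_b (rauzy_veech S)}"
proof (cases "top_type S")
  case True
  then show ?thesis
    using perm_last[OF data] last_tI[OF data'] by (simp add: rauzy_veech_top)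
next
  case False
  then show ?thesis
    using perm_last[OF data] last_bI[OF data'] by (simp add: rauzy_veech_bottom)
qed

end

subsection \<open>Return times\<close>

primrec return_time :: "'a::finite iet \<Rightarrow> nat \<Rightarrow> 'a \<Rightarrow> nat" where
  "return_time T 0 = (\<lambda>\<alpha>. 1)"
| "return_time T (Suc n) = (return_time T n)
     (loser (rv_iter T n) := return_time T n (loser (rv_iter T n)) + return_time T n (winner (rv_iter T n)))"

lemma rv_iter_0 [simp]: "rv_iter T 0 = T"
  and rv_iter_Suc: "rv_iter T (Suc n) = rauzy_veech (rv_iter T n)"
  by (simp_all add: rv_iter_def)

lemma return_time_pos: "return_time T n \<alpha> > 0"
  by (induction n arbitrary: \<alpha>) auto

lemma return_time_mono:
  assumes "m \<le> n"
  shows "return_time T m \<alpha> \<le> return_time T n \<alpha>"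
  using assms by (induction rule: dec_induct) (auto intro: le_trans)

locale keane_orbit =
  fixes T :: "'a::finite iet"
  assumes two: "CARD('a) \<ge> 2" and data_T: "iet_data T" and adm_T: "admissible T"
    and keane: "keane T" and total: "total_length T = 1"
begin

abbreviation "S n \<equiv> rv_iter T n"
abbreviation "win n \<equiv> winner (S n)"
abbreviation "los n \<equiv> loser (S n)"
abbreviation "r n \<equiv> return_time T n"

text \<open>The invariant of a joint induction: the data stay valid only if there are no ties, and
  ties are excluded by Keane's property through the last two clauses. The last clause later places
  endpoints in \<open>discont_pow\<close>.\<close>

definition first_return :: "nat \<Rightarrow> bool" where
  "first_return n \<longleftrightarrow> iet_data (S n) \<and> admissible (S n) \<and>
     (\<forall>\<alpha> x. x \<in> sub_ival (S n) \<alpha> \<longrightarrow> iet_map (S n) x = (iet_map T ^^ r n \<alpha>) x) \<and>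
     (\<forall>\<alpha>. perm_t (S n) \<alpha> > 1 \<longrightarrow> (\<exists>i<r n \<alpha>. (iet_map T ^^ i) (left_t (S n) \<alpha>) \<in> discont T))"

lemma first_returnD:
  assumes "first_return n"
  shows "iet_data (S n)" "admissible (S n)"
    "\<And>\<alpha> x. x \<in> sub_ival (S n) \<alpha> \<Longrightarrow> iet_map (S n) x = (iet_map T ^^ r n \<alpha>) x"
    "\<And>\<alpha>. perm_t (S n) \<alpha> > 1 \<Longrightarrow> \<exists>i<r n \<alpha>. (iet_map T ^^ i) (left_t (S n) \<alpha>) \<in> discont T"
  using assms unfolding first_return_def by blast+

text \<open>With a tie, the map of \<open>T(n)\<close> sends the left end of the bottom-last
  interval to that of the top-last one. The first orbit meets some \<open>left_t T \<alpha>'\<close>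
  before its return, the second meets a discontinuity of \<open>T\<close>, and this gives a
  connection forbidden by Keane's property.\<close>

lemma len_last_neq:
  assumes "first_return n"
  shows "len (S n) (last_t (S n)) \<noteq> len (S n) (last_b (S n))"
proof
  note fr = first_returnD[OF assms]
  let ?\<alpha> = "last_b (S n)" and ?\<beta> = "last_t (S n)"
  assume "len (S n) ?\<beta> = len (S n) ?\<alpha>"
  then have eq: "left_b (S n) ?\<alpha> = left_t (S n) ?\<beta>"
    using left_t_last[OF fr(1)] left_b_last[OF fr(1)] by simp
  have *: "(iet_map T ^^ r n ?\<alpha>) (left_t (S n) ?\<alpha>) = left_t (S n) ?\<beta>"
    using fr(3)[OF left_t_in_sub_ival[OF fr(1)]]
      iet_map_sub_ival[OF fr(1) left_t_in_sub_ival[OF fr(1)]] eq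
    by auto
  obtain i \<beta>' where i: "(iet_map T ^^ i) (left_t (S n) ?\<beta>) = left_t T \<beta>'" "perm_t T \<beta>' > 1"
    using fr(4)[of ?\<beta>] perm_last[OF fr(1)] two by (auto simp: discont_def)
  \<comment> \<open>If the bottom-last letter is first in the top row, its left end 0 is already
    such a point, with \<open>j = 0\<close>.\<close>
  obtain j \<alpha>' where j: "j < r n ?\<alpha>" "(iet_map T ^^ j) (left_t (S n) ?\<alpha>) = left_t T \<alpha>'"
  proof (cases "perm_t (S n) ?\<alpha> > 1")
    case True
    then show ?thesis using fr(4)[of ?\<alpha>] that by (auto simp: discont_def)
  next
    case False
    then have "left_t (S n) ?\<alpha> = 0"
      using left_t_first[OF fr(1)] perm_ge[OF fr(1)] by (metis le_antisym not_less)
    moreover obtain \<alpha>' where "perm_t T \<alpha>' = 1" using ex_perm(1)[OF data_T, of 1] two by auto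
    ultimately show ?thesis using that[of 0 \<alpha>'] left_t_first[OF data_T, of \<alpha>'] return_time_pos[of T n] by simp
  qed
  have "(iet_map T ^^ (i + (r n ?\<alpha> - j))) (left_t T \<alpha>') =
      (iet_map T ^^ i) ((iet_map T ^^ (r n ?\<alpha> - j + j)) (left_t (S n) ?\<alpha>))"
    using j(2) by (simp add: funpow_add)
  also have "\<dots> = left_t T \<beta>'" using * i j(1) by simp
  finally show False using keane i(2) j(1) unfolding keane_def
    by (metis One_nat_def Suc_leI add_gr_0 zero_less_diff)
qed

lemma first_return: "first_return n"
proof (induction n)
  case 0
  have "\<exists>i<r 0 \<alpha>. (iet_map T ^^ i) (left_t T \<alpha>) \<in> discont T" if "perm_t T \<alpha> > 1" for \<alpha>
    using that by (auto simp: discont_def)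
  then show ?case unfolding first_return_def using data_T adm_T by auto
next
  case (Suc n)
  note fr = first_returnD[OF Suc] and S' = rv_iter_Suc[of T n]
  note neq = winner_neq_loser[OF fr(1,2) two]
  have data': "iet_data (S (Suc n))"
    unfolding S' using iet_data_rauzy_veech[OF fr(1,2) two len_last_neq[OF Suc]] .
  have adm': "admissible (S (Suc n))"
    unfolding S' using admissible_rauzy_veech[OF fr(1,2) two] .
  have map': "iet_map (S (Suc n)) x = (iet_map T ^^ r (Suc n) \<alpha>) x"
    if x: "x \<in> sub_ival (S (Suc n)) \<alpha>" for \<alpha> x
  proof (cases "\<alpha> = los n")
    case False
    note other = iet_map_rauzy_veech_other[OF fr(1,2) two data'[unfolded S'] x[unfolded S'] False]
    show ?thesis using other(2) fr(3)[OF other(1)] False by (simp add: S')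
  next
    case True
    obtain \<beta> \<gamma> where bc: "{\<beta>, \<gamma>} = {los n, win n}" "\<beta> \<noteq> \<gamma>" "x \<in> sub_ival (S n) \<beta>"
      "iet_map (S n) x \<in> sub_ival (S n) \<gamma>"
      "iet_map (S (Suc n)) x = iet_map (S n) (iet_map (S n) x)"
      using iet_map_rauzy_veech_loser[OF fr(1,2) two data'[unfolded S'], of x] x
      unfolding S' True by blast
    have "iet_map (S (Suc n)) x = (iet_map T ^^ (r n \<gamma> + r n \<beta>)) x"
      using bc fr(3)[OF bc(3)] fr(3)[OF bc(4)] by (simp add: funpow_add)
    moreover have "r n \<gamma> + r n \<beta> = r (Suc n) \<alpha>"
      using bc(1,2) True neq by (auto simp: doubleton_eq_iff)
    ultimately show ?thesis by simp
  qed
  have disc': "\<exists>i<r (Suc n) \<alpha>. (iet_map T ^^ i) (left_t (S (Suc n)) \<alpha>) \<in> discont T"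
    if \<alpha>: "perm_t (S (Suc n)) \<alpha> > 1" for \<alpha>
  proof (cases "top_type (S n)")
    case True
    then obtain i where "i < r n \<alpha>" "(iet_map T ^^ i) (left_t (S (Suc n)) \<alpha>) \<in> discont T"
      using fr(4)[of \<alpha>] \<alpha> 
      by (auto simp: S' rauzy_veech_top[OF fr(1,2) two] left_rauzy_veech_top[OF fr(1,2) two])
    then show ?thesis by (intro exI[of _ i]) auto
  next
    case False
    note rv = rauzy_veech_bottom[OF fr(1,2) two False] left_rauzy_veech_bottom[OF fr(1,2) two False]
    show ?thesis
    proof (cases "\<alpha> = los n")
      case notlos: False
      have "perm_t (S n) \<alpha> > 1"
        using \<alpha> notlos perm_ge[OF fr(1), of "last_b (S n)"]
        by (auto simp: S' rv move_after_def split: if_splits)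
      then obtain i where "i < r n \<alpha>" "(iet_map T ^^ i) (left_t (S n) \<alpha>) \<in> discont T"
        using fr(4)[of \<alpha>] by auto
      then show ?thesis using notlos by (auto simp: S' rv)
    next
      case los: True
      have "perm_t (S n) (last_t (S n)) > 1" using perm_last[OF fr(1)] two by simp
      then obtain i where i: "i < r n (last_t (S n))"
        "(iet_map T ^^ i) (left_t (S n) (last_t (S n))) \<in> discont T"
        using fr(4) by blast
      \<comment> \<open>The loser gets a new left end inside the old interval of the winner. The map
        of \<open>T(n)\<close> sends it to the old left end of the loser, so the discontinuity is
        met later by the return time of the winner.\<close>
      let ?y = "left_t (S (Suc n)) \<alpha>"
      have y: "?y = left_t (S n) (last_b (S n)) + len (S n) (last_b (S n)) - len (S n) (last_t (S n))"
        using los by (simp add: S' rv)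
      have sub: "?y \<in> sub_ival (S n) (last_b (S n))"
        using False len_pos[OF fr(1)] unfolding y by (simp add: sub_ival_def top_type_def)
      have "iet_map (S n) ?y = left_t (S n) (last_t (S n))"
        using left_t_last[OF fr(1)] left_b_last[OF fr(1)]
        unfolding iet_map_sub_ival[OF fr(1) sub] unfolding y by simp
      then have "(iet_map T ^^ (i + r n (last_b (S n)))) ?y \<in> discont T"
        using fr(3)[OF sub] i by (simp add: funpow_add)
      then show ?thesis using i los by (intro exI[of _ "i + r n (last_b (S n))"]) (simp add: rv)
    qed
  qed
  show ?case unfolding first_return_def using data' adm' map' disc' by blast
qed

lemmas data = first_returnD(1)[OF first_return]
  and adm = first_returnD(2)[OF first_return]

lemma win_neq_los: "win n \<noteq> los n"
  using winner_neq_loser[OF data adm two] .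

lemma len_Suc: "len (S (Suc n)) \<alpha> = (if \<alpha> = win n then len (S n) \<alpha> - len (S n) (los n) else len (S n) \<alpha>)"
  by (simp add: rv_iter_Suc rauzy_veech_def)

lemma dom_ival_subset: "dom_ival (S n) \<subseteq> dom_ival T"
proof (induction n)
  case (Suc n)
  have "total_length (S (Suc n)) \<le> total_length (S n)"
    unfolding total_length_def using len_nonneg[OF data] by (intro sum_mono) (simp add: len_Suc)
  then show ?case using Suc by (auto simp: dom_ival_def)
qed simp

text \<open>Area is conserved: the step cuts a piece as wide as the loser from the tower of the
  winner and stacks it with the tower of the loser.\<close>

lemma sum_len_return_time: "(\<Sum>\<alpha>\<in>UNIV. len (S n) \<alpha> * r n \<alpha>) = 1"
proof (induction n)
  case 0
  then show ?case using total by (simp add: total_length_def)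
next
  case (Suc n)
  let ?l = "len (S n)" and ?w = "win n" and ?s = "los n"
  have split: "sum f UNIV = f ?w + f ?s + sum f (UNIV - {?w} - {?s})" for f :: "'a \<Rightarrow> real"
    using win_neq_los[of n] sum.remove[of UNIV ?w f] sum.remove[of "UNIV - {?w}" ?s f] by simp
  have "(\<Sum>\<alpha>\<in>UNIV - {?w} - {?s}. len (S (Suc n)) \<alpha> * r (Suc n) \<alpha>) =
      (\<Sum>\<alpha>\<in>UNIV - {?w} - {?s}. ?l \<alpha> * r n \<alpha>)"
    by (intro sum.cong) (auto simp: len_Suc)
  then show ?case
    using Suc win_neq_los[of n] win_neq_los[of n, symmetric]
    by (simp add: split len_Suc algebra_simps)
qed

lemma len_return_time_le: "len (S n) \<alpha> * r n \<alpha> \<le> 1"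
proof -
  have "len (S n) \<alpha> * r n \<alpha> \<le> (\<Sum>\<alpha>\<in>UNIV. len (S n) \<alpha> * r n \<alpha>)"
    using len_nonneg[OF data] by (intro member_le_sum) auto
  then show ?thesis by (simp add: sum_len_return_time)
qed

text \<open>The winner stays last in its row, so it competes in the next step too and loses it
  unless it wins again.\<close>

lemma los_Suc:
  assumes "win n \<noteq> win (Suc n)"
  shows "los (Suc n) = win n"
  using winner_last_rauzy_veech[OF data adm two, folded rv_iter_Suc, OF data, of n] assms
  by (auto simp: winner_def loser_def split: if_splits)

section \<open>Total return time and lower bounds for the lengths\<close>

definition N :: "nat \<Rightarrow> nat" where
  "N n = (\<Sum>\<alpha>\<in>UNIV. r n \<alpha>)"

lemma return_time_le_N: "r n \<alpha> \<le> N n"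
  unfolding N_def by (intro member_le_sum) auto

lemma N_mono: "m \<le> n \<Longrightarrow> N m \<le> N n"
  unfolding N_def by (intro sum_mono return_time_mono)

lemma N_pos: "N n > 0"
  using return_time_le_N return_time_pos by (metis gr0I le_0_eq less_numeral_extra(3))

lemma N_Suc: "N (Suc n) = N n + r n (win n)"
proof -
  have "sum (r (Suc n)) UNIV = r n (los n) + r n (win n) + sum (r (Suc n)) (UNIV - {los n})"
    by (subst sum.remove[of UNIV "los n"]) auto
  also have "sum (r (Suc n)) (UNIV - {los n}) = sum (r n) (UNIV - {los n})"
    by (intro sum.cong) auto
  also have "r n (los n) + r n (win n) + \<dots> = r n (win n) + sum (r n) UNIV"
    by (subst sum.remove[of UNIV "los n" "r n"]) auto
  finally show ?thesis by (simp add: N_def)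
qed

lemma N_Suc_le: "N (Suc n) \<le> 2 * N n"
  using N_Suc return_time_le_N[of n "win n"] by simp

lemma left_t_discont_pow:
  assumes "r n \<alpha> \<le> M"
  shows "left_t (S n) \<alpha> \<in> discont_pow T M \<union> {0, 1}"
proof (cases "perm_t (S n) \<alpha> > 1")
  case True
  then obtain i where "i < r n \<alpha>" "(iet_map T ^^ i) (left_t (S n) \<alpha>) \<in> discont T"
    using first_returnD(4)[OF first_return] by blast
  moreover have "left_t (S n) \<alpha> \<in> dom_ival T"
    using left_t_in_sub_ival[OF data] sub_ival_subset[OF data] dom_ival_subset by blast
  ultimately show ?thesis using assms unfolding discont_pow_def by fastforce
next
  case False
  then have "perm_t (S n) \<alpha> = 1" using perm_ge(1)[OF data, of n \<alpha>] by simp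
  then show ?thesis using left_t_first[OF data] by simp
qed

lemma right_t_discont_pow:
  assumes "N n \<le> M" "\<alpha> \<noteq> last_t (S n)"
  shows "left_t (S n) \<alpha> + len (S n) \<alpha> \<in> discont_pow T M \<union> {0, 1}"
proof -
  have "perm_t (S n) \<alpha> < CARD('a)"
    using assms(2) last_tI[OF data] perm_le(1)[OF data] by (metis le_neq_implies_less)
  then obtain \<beta> where \<beta>: "perm_t (S n) \<beta> = Suc (perm_t (S n) \<alpha>)"
    using ex_perm(1)[OF data, of "Suc (perm_t (S n) \<alpha>)"] by auto
  have "left_t (S n) \<beta> = left_t (S n) \<alpha> + len (S n) \<alpha>"
    using offset_next[OF inj_perm(1)[OF data] \<beta>] by (simp add: left_t_offset)
  then show ?thesis using left_t_discont_pow[of n \<beta> M] return_time_le_N[of n \<beta>] assms(1) by simp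
qed

lemma min_spacing_le_len_not_last:
  assumes "N n \<le> M" "\<alpha> \<noteq> last_t (S n)"
  shows "min_spacing T M \<le> len (S n) \<alpha>"
  using min_spacing_le[OF data_T right_t_discont_pow[OF assms] left_t_discont_pow[of n \<alpha> M]]
    return_time_le_N[of n \<alpha>] assms(1) len_pos[OF data, of n \<alpha>]
  by simp

text \<open>The top-last interval has no right neighbour to supply its right end. In the top type
  the bottom-last letter is shorter and takes its place. In the bottom type one more step supplies
  two suitable points, and \<open>N_Suc_le\<close> explains the factor 2.\<close>

lemma min_spacing_le_len: "min_spacing T (2 * N n) \<le> len (S n) \<alpha>"
proof (cases "\<alpha> = last_t (S n)")
  case False
  then show ?thesis by (intro min_spacing_le_len_not_last) auto
next
  case True
  note neq = last_neq[OF data adm two]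
  show ?thesis
  proof (cases "top_type (S n)")
    case top: True
    then have "len (S n) (last_b (S n)) < len (S n) \<alpha>" by (simp add: top_type_def True)
    moreover have "min_spacing T (2 * N n) \<le> len (S n) (last_b (S n))"
      using neq by (intro min_spacing_le_len_not_last) (auto simp: eq_commute)
    ultimately show ?thesis by simp
  next
    case bottom: False
    \<comment> \<open>After the step, the interval of the loser ends where that of the winner ended before.\<close>
    let ?w = "last_b (S n)"
    have "left_t (S (Suc n)) \<alpha> = left_t (S n) ?w + len (S n) ?w - len (S n) \<alpha>"
      using True by (simp add: rv_iter_Suc left_rauzy_veech_bottom[OF data adm two bottom])
    moreover have "left_t (S (Suc n)) \<alpha> \<in> discont_pow T (2 * N n) \<union> {0, 1}"
      using return_time_le_N[of "Suc n" \<alpha>] N_Suc_le[of n] by (intro left_t_discont_pow) simp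
    moreover have "left_t (S n) ?w + len (S n) ?w \<in> discont_pow T (2 * N n) \<union> {0, 1}"
      using neq by (intro right_t_discont_pow) (auto simp: eq_commute)
    ultimately show ?thesis
      using min_spacing_le[OF data_T, of "left_t (S n) ?w + len (S n) ?w" _ "left_t (S (Suc n)) \<alpha>"]
        len_pos[OF data, of n \<alpha>] by simp
  qed
qed

end

subsection \<open>Isolated sets of winners\<close>

lemma initial_segment_vimage:
  fixes p :: "'a::finite \<Rightarrow> nat"
  assumes bij: "bij_betw p UNIV {1..CARD('a)}" and less: "\<And>x y. x \<in> A \<Longrightarrow> y \<notin> A \<Longrightarrow> p x < p y"
  shows "A = p -` {1..card A}"
proof -
  have inj: "inj p" and range: "range p = {1..CARD('a)}" using bij by (auto simp: bij_betw_def)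
  have "p ` A = {1..card (p ` A)}"
  proof (cases "A = {}")
    case False
    let ?m = "Max (p ` A)"
    have "?m \<in> p ` A" using False by (intro Max_in) auto
    then obtain x where x: "x \<in> A" "p x = ?m" by auto
    have "{1..?m} \<subseteq> p ` A"
    proof
      fix k assume k: "k \<in> {1..?m}"
      then have "k \<in> range p" using range x(2) by (metis atLeastAtMost_iff le_trans rangeI)
      then obtain y where "p y = k" by auto
      then show "k \<in> p ` A" using less[OF x(1), of y] x(2) k by force
    qed
    moreover have "p ` A \<subseteq> {1..?m}" using range by auto
    ultimately have "p ` A = {1..?m}" by blast
    then show ?thesis by (metis card_atLeastAtMost diff_Suc_1)
  qed simp
  moreover have "card (p ` A) = card A" using inj by (metis card_image inj_on_subset subset_UNIV)
  ultimately show ?thesis using inj by (metis inj_vimage_image_eq)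
qed

text \<open>The part of \<open>W\<close> that forms a block at the right end of the row. The joint
  size of the blocks in both rows is the monovariant for steps whose winner and loser lie in
  \<open>W\<close>.\<close>

definition right_of :: "'a set \<Rightarrow> ('a \<Rightarrow> nat) \<Rightarrow> 'a set" where
  "right_of W p = {\<beta>. \<forall>x. x \<notin> W \<longrightarrow> p x < p \<beta>}"

lemma last_in_right_of:
  assumes "inj p" "\<And>\<beta>. p \<beta> \<le> p a" "a \<in> W"
  shows "a \<in> right_of W p"
  using assms by (auto simp: right_of_def) (metis injD le_neq_implies_less)

text \<open>Being last, \<open>a\<close> starts in the block; it lands directly behind
  \<open>w\<close>, so it stays in the block exactly if \<open>w\<close> is there. All other letters
  keep their order relative to letters outside \<open>W\<close>.\<close>

lemma right_of_move_after:
  assumes inj: "inj p" and max: "\<And>\<beta>. p \<beta> \<le> p a" and wa: "w \<noteq> a" and W: "a \<in> W" "w \<in> W"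
  shows "right_of W (move_after a w p) = (if w \<in> right_of W p then right_of W p else right_of W p - {a})"
proof -
  have other: "\<beta> \<in> right_of W (move_after a w p) \<longleftrightarrow> \<beta> \<in> right_of W p" if "\<beta> \<noteq> a" for \<beta>
  proof -
    have "move_after a w p x < move_after a w p \<beta> \<longleftrightarrow> p x < p \<beta>" if "x \<notin> W" for x
      using that \<open>\<beta> \<noteq> a\<close> W by (auto simp: move_after_def)
    then show ?thesis by (auto simp: right_of_def)
  qed
  have "a \<in> right_of W (move_after a w p) \<longleftrightarrow> w \<in> right_of W p"
  proof -
    have "move_after a w p x < move_after a w p a \<longleftrightarrow> p x < p w" if "x \<notin> W" for x
    proof -
      have "x \<noteq> a" "p x \<noteq> p w" using that W inj by (auto dest: injD)
      then show ?thesis by (auto simp: move_after_def)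
    qed
    then show ?thesis by (auto simp: right_of_def)
  qed
  moreover have "a \<in> right_of W p" using last_in_right_of[OF inj max W(1)] .
  ultimately have "x \<in> right_of W (move_after a w p) \<longleftrightarrow>
      x \<in> (if w \<in> right_of W p then right_of W p else right_of W p - {a})" for x
    using other by (cases "x = a") auto
  then show ?thesis by blast
qed

context keane_orbit
begin

abbreviation "right_t W n \<equiv> right_of W (perm_t (S n))"
abbreviation "right_b W n \<equiv> right_of W (perm_b (S n))"
abbreviation "right_card W n \<equiv> card (right_t W n) + card (right_b W n)"

text \<open>The loser is last in the row that changes: either it drops out of that block, or the
  winner belongs to the block. In the other row the winner is itself last and thus in the
  block.\<close>

lemma right_of_Suc:
  assumes "win n \<in> W" "los n \<in> W"
  shows "right_card W (Suc n) < right_card W n \<or>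
    right_t W (Suc n) = right_t W n \<and> right_b W (Suc n) = right_b W n \<and>
    win n \<in> right_t W n \<inter> right_b W n"
proof -
  note facts = inj_perm[OF data] perm_le_last[OF data] last_neq[OF data adm two]
  have psub: "card (right_of W p - {a}) < card (right_of W p)" if "a \<in> right_of W p" for p :: "'a \<Rightarrow> nat" and a
    using that by (intro psubset_card_mono) auto
  show ?thesis
  proof (cases "top_type (S n)")
    case True
    note rv = rauzy_veech_top[OF data adm two True]
    have mem: "last_t (S n) \<in> right_t W n" "last_b (S n) \<in> right_b W n"
      using assms facts by (auto simp: rv intro!: last_in_right_of)
    have "right_b W (Suc n) = (if last_t (S n) \<in> right_b W n then right_b W n
        else right_b W n - {last_b (S n)})"
      using assms facts unfolding rv rv_iter_Suc by (intro right_of_move_after) auto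
    moreover have "right_t W (Suc n) = right_t W n" by (simp add: rv rv_iter_Suc)
    ultimately show ?thesis using mem psub[OF mem(2)] by (simp add: rv split: if_splits)
  next
    case False
    note rv = rauzy_veech_bottom[OF data adm two False]
    have mem: "last_t (S n) \<in> right_t W n" "last_b (S n) \<in> right_b W n"
      using assms facts by (auto simp: rv intro!: last_in_right_of)
    have "right_t W (Suc n) = (if last_b (S n) \<in> right_t W n then right_t W n
        else right_t W n - {last_t (S n)})"
      using assms facts(1,2,3,4) facts(5)[symmetric] unfolding rv rv_iter_Suc
      by (intro right_of_move_after) auto
    moreover have "right_b W (Suc n) = right_b W n" by (simp add: rv rv_iter_Suc)
    ultimately show ?thesis using mem psub[OF mem(1)] by (simp add: rv split: if_splits)
  qed
qed

lemma winners_Suc: "m \<le> n \<Longrightarrow> winners T m (Suc n) = insert (win n) (winners T m n)"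
  by (auto simp: winners_def atLeastLessThanSuc)

lemma winners_self [simp]: "winners T n n = {}"
  by (simp add: winners_def)

lemma winners_Un: "l \<le> m \<Longrightarrow> m \<le> n \<Longrightarrow> winners T l n = winners T l m \<union> winners T m n"
  unfolding winners_def by (metis ivl_disj_un_two(3) image_Un)

lemma winners_mono: "l' \<le> l \<Longrightarrow> m \<le> m' \<Longrightarrow> winners T l m \<subseteq> winners T l' m'"
  unfolding winners_def by (intro image_mono) auto

lemma right_of_window:
  assumes "a \<le> b" "winners T a b \<subseteq> W" "\<And>n. a \<le> n \<Longrightarrow> n < b \<Longrightarrow> los n \<in> W"
  shows "right_card W b < right_card W a \<or>
    right_t W b = right_t W a \<and> right_b W b = right_b W a \<and>
    winners T a b \<subseteq> right_t W a \<inter> right_b W a"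
  using assms
proof (induction rule: dec_induct)
  case (step n)
  then have IH: "right_card W n < right_card W a \<or>
    right_t W n = right_t W a \<and> right_b W n = right_b W a \<and>
    winners T a n \<subseteq> right_t W a \<inter> right_b W a"
    by (auto simp: winners_Suc)
  have "win n \<in> W" "los n \<in> W" using step by (auto simp: winners_Suc)
  from right_of_Suc[OF this] IH show ?case
    using step(1) by (auto simp: winners_Suc)
qed simp

text \<open>Otherwise both blocks stay the same and contain every winner, hence all of
  \<open>W\<close>. Then the complement of \<open>W\<close> fills the same initial places in both
  rows, against admissibility.\<close>

lemma right_card_less:
  assumes ab: "a \<le> b" and W: "winners T a b = W" "W \<noteq> {}" "W \<noteq> UNIV"
    and los: "\<And>n. a \<le> n \<Longrightarrow> n < b \<Longrightarrow> los n \<in> W"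
  shows "right_card W b < right_card W a"
proof (rule ccontr)
  assume "\<not> ?thesis"
  then have "W \<subseteq> right_t W a" "W \<subseteq> right_b W a"
    using right_of_window[OF ab _ los] W(1) by auto
  then have less: "perm_t (S a) x < perm_t (S a) y" "perm_b (S a) x < perm_b (S a) y"
    if "x \<in> -W" "y \<notin> -W" for x y
    using that by (auto simp: right_of_def)
  have "-W = perm_t (S a) -` {1..card (-W)}" "-W = perm_b (S a) -` {1..card (-W)}"
    using less by (intro initial_segment_vimage bij_perm[OF data]; blast)+
  then have "perm_t (S a) -` {1..card (-W)} = perm_b (S a) -` {1..card (-W)}" by metis
  moreover have "1 \<le> card (-W)" using W(3) by (auto simp: Suc_le_eq card_gt_0_iff)
  moreover have "card (-W) < CARD('a)" using W(2) by (intro psubset_card_mono) auto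
  ultimately show False using adm[of a] by (auto simp: admissible_def)
qed

text \<open>A relation, so that \<open>k\<close> adjacent windows form its \<open>k\<close>-th
  power.\<close>

definition full_window :: "'a set \<Rightarrow> nat rel" where
  "full_window W = {(a, b). a \<le> b \<and> winners T a b = W}"

lemma full_window_relpow_le:
  assumes "(a, b) \<in> full_window W ^^ k"
  shows "a \<le> b"
  using assms by (induction k arbitrary: b) (auto simp: full_window_def, force)

text \<open>The two block sizes add up to at most \<open>2 * CARD('a)\<close>, and each window
  without a loser outside \<open>W\<close> lowers this sum, so one window more is too many.\<close>

lemma ex_loser_notin:
  assumes "(a, b) \<in> full_window W ^^ Suc (2 * CARD('a))" "W \<noteq> {}" "W \<noteq> UNIV"
  shows "\<exists>n. a \<le> n \<and> n < b \<and> los n \<notin> W"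
proof (rule ccontr)
  assume *: "\<not> ?thesis"
  have "right_card W c + k \<le> right_card W a"
    if "(a, c) \<in> full_window W ^^ k" "c \<le> b" for k c
    using that
  proof (induction k arbitrary: c)
    case (Suc k)
    then obtain c' where c': "(a, c') \<in> full_window W ^^ k" "c' \<le> c" "winners T c' c = W"
      by (auto simp: full_window_def)
    have "right_card W c < right_card W c'"
      using assms c' Suc.prems * full_window_relpow_le[OF c'(1)]
      by (intro right_card_less) (auto intro: le_trans)
    then show ?case using Suc.IH[OF c'(1)] c'(2) Suc.prems(2) by simp
  qed simp
  from this[OF assms(1)] have "right_card W b + Suc (2 * CARD('a)) \<le> right_card W a" by simp
  moreover have "card (right_t W a) \<le> CARD('a)" "card (right_b W a) \<le> CARD('a)"
    by (intro card_mono; simp)+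
  ultimately show False by linarith
qed

subsection \<open>Every letter wins infinitely often\<close>

text \<open>A letter that has stopped winning keeps its length, while each loss raises its return
  time. Infinitely many losses would violate \<open>len_return_time_le\<close>.\<close>

lemma ex_last_loss:
  assumes x: "\<And>n. n \<ge> s \<Longrightarrow> win n \<noteq> x"
  shows "\<exists>s'\<ge>s. \<forall>n\<ge>s'. los n \<noteq> x"
proof (rule ccontr)
  assume contra: "\<not> ?thesis"
  have len: "len (S n) x = len (S s) x" if "s \<le> n" for n
    using that by (induction rule: dec_induct) (use x in \<open>auto simp: len_Suc\<close>)
  have "\<exists>n\<ge>s. r n x \<ge> k" for k
  proof (induction k)
    case (Suc k)
    then obtain n where n: "n \<ge> s" "r n x \<ge> k" by blast
    obtain n' where n': "n' \<ge> n" "los n' = x" using contra n(1) by blast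
    have "r (Suc n') x > r n' x" using n'(2) return_time_pos[of T n' "win n'"] by auto
    then show ?case using return_time_mono[OF n'(1), of T x] n n' by (intro exI[of _ "Suc n'"]) auto
  qed auto
  then obtain n where n: "n \<ge> s" "r n x \<ge> nat \<lceil>1 / len (S s) x\<rceil> + 1" by blast
  then have "real (r n x) > 1 / len (S s) x" by linarith
  then have "len (S s) x * r n x > 1"
    using len_pos[OF data, of s x] by (simp add: field_simps)
  then show False using len_return_time_le[of n x] len[OF n(1)] by simp
qed

text \<open>Let \<open>W\<close> be the set of letters that win infinitely often. From some time on
  all winners and, by \<open>ex_last_loss\<close>, all losers lie in \<open>W\<close>, so
  \<open>ex_loser_notin\<close> excludes \<open>W \<noteq> UNIV\<close>.\<close>

lemma ex_winners_UNIV: "\<exists>n\<ge>s. winners T s n = UNIV"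
proof -
  define W where "W = {w. \<forall>n. \<exists>m\<ge>n. win m = w}"
  have wins: "\<exists>b\<ge>a. V \<subseteq> winners T a b" if "V \<subseteq> W" for V a
    using finite[of V] that
  proof (induction V rule: finite_induct)
    case (insert v V)
    then obtain b where b: "b \<ge> a" "V \<subseteq> winners T a b" by auto
    obtain m where m: "m \<ge> a" "win m = v" using insert.prems by (auto simp: W_def)
    have "insert v V \<subseteq> winners T a (max b (Suc m))"
      using b m winners_mono[of a a b "max b (Suc m)"] by (auto simp: winners_def)
    then show ?case using b by (intro exI[of _ "max b (Suc m)"]) auto
  qed auto
  have "\<exists>s'. \<forall>n\<ge>s'. win n \<noteq> x \<and> los n \<noteq> x" if "x \<notin> W" for x
  proof -
    obtain s1 where "\<And>n. n \<ge> s1 \<Longrightarrow> win n \<noteq> x" using \<open>x \<notin> W\<close> by (auto simp: W_def)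
    from this ex_last_loss[OF this] show ?thesis by (meson le_trans)
  qed
  then obtain f where f: "\<And>x n. x \<notin> W \<Longrightarrow> n \<ge> f x \<Longrightarrow> win n \<noteq> x \<and> los n \<noteq> x" by metis
  define s0 where "s0 = Max (range f)"
  have s0: "win n \<in> W" "los n \<in> W" if "n \<ge> s0" for n
  proof -
    have "f x \<le> n" for x
      using that Max_ge[of "range f" "f x"] by (simp add: s0_def)
    then show "win n \<in> W" "los n \<in> W" using f by blast+
  qed
  have "W = UNIV"
  proof (rule ccontr)
    assume "W \<noteq> UNIV"
    have "\<exists>b. (s0, b) \<in> full_window W ^^ k" for k
    proof (induction k)
      case (Suc k)
      then obtain b where b: "(s0, b) \<in> full_window W ^^ k" by blast
      obtain c where c: "c \<ge> b" "W \<subseteq> winners T b c" using wins by blast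
      have "winners T b c \<subseteq> W"
        using s0 full_window_relpow_le[OF b] by (auto simp: winners_def)
      then have "(b, c) \<in> full_window W" using c by (auto simp: full_window_def)
      then show ?case using b by auto
    qed auto
    then obtain b where "(s0, b) \<in> full_window W ^^ Suc (2 * CARD('a))" by blast
    from ex_loser_notin[OF this] s0 \<open>W \<noteq> UNIV\<close> show False by blast
  qed
  then show ?thesis using wins[of UNIV s] by auto
qed

text \<open>The greatest time exists: a window of one step has a single winner, which is not all of
  the alphabet, and a window won by all letters bounds the candidates. By maximality all letters
  have won one step later.\<close>

lemma
  shows mmy_time_less: "mmy_time T k < mmy_time T (Suc k)"
    and winners_mmy_time: "winners T (mmy_time T k) (mmy_time T (Suc k)) \<noteq> UNIV"
    and winners_Suc_mmy_time: "winners T (mmy_time T k) (Suc (mmy_time T (Suc k))) = UNIV"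
proof -
  let ?m = "mmy_time T k"
  let ?P = "\<lambda>m. m > ?m \<and> winners T ?m m \<noteq> UNIV"
  obtain n where n: "n \<ge> ?m" "winners T ?m n = UNIV" using ex_winners_UNIV by blast
  have bound: "\<forall>m. ?P m \<longrightarrow> m \<le> n"
    using n winners_mono[of ?m ?m n] by (metis nat_le_linear order_refl top.extremum_uniqueI)
  have "card {win ?m} < CARD('a)" using two by simp
  then have "{win ?m} \<noteq> UNIV" by (metis less_irrefl)
  then have "?P (Suc ?m)" by (simp add: winners_Suc)
  then have "?P (Greatest ?P)" using bound GreatestI_nat[of ?P "Suc ?m" n] by blast
  then have P: "?P (mmy_time T (Suc k))" by simp
  then show "?m < mmy_time T (Suc k)" "winners T ?m (mmy_time T (Suc k)) \<noteq> UNIV" by auto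
  have "\<not> ?P (Suc (Greatest ?P))"
    using Greatest_le_nat[of ?P "Suc (Greatest ?P)" n] bound by auto
  then show "winners T ?m (Suc (mmy_time T (Suc k))) = UNIV" using P by (simp add: less_Suc_eq)
qed

end

lemma relpow_Int_subset:
  fixes A B :: "'a rel"
  shows "(A \<inter> B) ^^ k \<subseteq> A ^^ k" "(A \<inter> B) ^^ k \<subseteq> B ^^ k"
  by (induction k) auto

context keane_orbit
begin

subsection \<open>Propagation of return times\<close>

text \<open>Between a win in \<open>X\<close> and a later win outside \<open>X\<close> two
  consecutive winners leave \<open>X\<close>, and by \<open>los_Suc\<close> the former loses to the
  latter.\<close>

lemma ex_switch:
  assumes "w1 \<in> winners T a b" "w1 \<in> X" "w2 \<in> winners T b c" "w2 \<notin> X"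
  shows "\<exists>t\<ge>a. Suc t < c \<and> win t \<in> X \<and> win (Suc t) \<notin> X \<and> los (Suc t) = win t"
proof -
  obtain t1 t2 where t: "a \<le> t1" "t1 < b" "b \<le> t2" "t2 < c" "win t1 \<in> X" "win t2 \<notin> X"
    using assms by (auto simp: winners_def)
  have "\<exists>t\<ge>t1. Suc t \<le> t2 \<and> win t \<in> X \<and> win (Suc t) \<notin> X"
    using order_trans[OF less_imp_le[OF t(2)] t(3)] t(6)
  proof (induction rule: dec_induct)
    case base
    then show ?case using t by simp
  next
    case (step m)
    then show ?case by (cases "win m \<in> X") (force intro: le_SucI)+
  qed
  then obtain t' where t': "t' \<ge> t1" "Suc t' \<le> t2" "win t' \<in> X" "win (Suc t') \<notin> X" by blast
  then have "los (Suc t') = win t'" using los_Suc[of t'] by metis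
  then show ?thesis using t t' by (intro exI[of _ t']) auto
qed

text \<open>A letter \<open>y\<close> that is still small at \<open>c\<close> wins in the first
  window, the large letter \<open>x\<close> in the second. Where the winner switches from small to
  large, the small one loses to the large one and becomes large.\<close>

lemma more_large:
  assumes win: "winners T a b = UNIV" "winners T b c = UNIV"
    and x: "q \<le> r a x" and y: "\<not> q \<le> r c y"
  shows "{\<alpha>. q \<le> r a \<alpha>} \<subset> {\<alpha>. q \<le> r c \<alpha>}"
proof -
  let ?X = "{\<alpha>. q \<le> r a \<alpha>}"
  have "a < b" "b < c" using win by (auto simp: winners_def intro: ccontr)
  then have "a \<le> c" by simp
  then have mono: "?X \<subseteq> {\<alpha>. q \<le> r c \<alpha>}" using return_time_mono[of a c T] by (auto intro: le_trans)
  have "y \<in> - ?X" using y mono by auto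
  then obtain t where t: "t \<ge> a" "Suc t < c" "win t \<notin> ?X" "win (Suc t) \<in> ?X" "los (Suc t) = win t"
    using ex_switch[of y a b "- ?X" x c] win x by auto
  have "q \<le> r (Suc t) (win (Suc t))"
    using t(4) return_time_mono[of a "Suc t" T "win (Suc t)"] t(1) by simp
  also have "\<dots> \<le> r (Suc (Suc t)) (win t)"
    using t(5) by (simp del: return_time.simps(2) add: return_time.simps(2)[of _ "Suc t"])
  also have "\<dots> \<le> r c (win t)" using t(2) by (intro return_time_mono) simp
  finally show ?thesis using t(3) mono by auto
qed

text \<open>Starting from \<open>\<alpha>\<close> alone, each pair of windows adds a letter whose
  return time is at least \<open>r a \<alpha>\<close>, until all are reached.\<close>

lemma large_everywhere:
  assumes "(a, b) \<in> full_window UNIV ^^ (2 * CARD('a))"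
  shows "r a \<alpha> \<le> r b \<beta>"
proof -
  let ?q = "r a \<alpha>"
  have "min CARD('a) (Suc k) \<le> card {\<beta>. ?q \<le> r b \<beta>}"
    if "(a, b) \<in> full_window UNIV ^^ (2 * k)" for k b
    using that
  proof (induction k arbitrary: b)
    case 0
    then have "{\<beta>. ?q \<le> r b \<beta>} \<noteq> {}" by auto
    then show ?case by (simp add: Suc_le_eq card_gt_0_iff)
  next
    case (Suc k)
    then obtain c d where cd: "(a, c) \<in> full_window UNIV ^^ (2 * k)" "winners T c d = UNIV"
      "winners T d b = UNIV"
      by (auto simp: full_window_def)
    show ?case
    proof (cases "{\<beta>. ?q \<le> r b \<beta>} = UNIV")
      case False
      then obtain y where "\<not> ?q \<le> r b y" by auto
      moreover have "?q \<le> r c \<alpha>"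
        using return_time_mono full_window_relpow_le[OF cd(1)] by blast
      ultimately have "card {\<beta>. ?q \<le> r c \<beta>} < card {\<beta>. ?q \<le> r b \<beta>}"
        using more_large[OF cd(2,3)] by (intro psubset_card_mono) auto
      then show ?thesis using Suc.IH[OF cd(1)] by simp
    qed simp
  qed
  from this[OF assms] have "{\<beta>. ?q \<le> r b \<beta>} = UNIV"
    by (intro card_seteq) simp_all
  then show ?thesis by auto
qed

text \<open>The switch argument backwards in time: a letter low at \<open>c\<close> loses to one
  that is not, and so bounds the return time that the latter had at \<open>a\<close>.\<close>

lemma more_low:
  assumes win: "winners T a b = W" "winners T b c = W"
    and x: "x \<in> W" "r c x \<le> q" and y: "y \<in> W" "\<not> r a y \<le> q"
  shows "{\<alpha>. r c \<alpha> \<le> q} \<subset> {\<alpha>. r a \<alpha> \<le> q}"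
proof -
  let ?X = "{\<alpha>. r c \<alpha> \<le> q}"
  have "a < b" "b < c" using win x by (auto simp: winners_def intro: ccontr)
  then have "a \<le> c" by simp
  then have mono: "?X \<subseteq> {\<alpha>. r a \<alpha> \<le> q}" using return_time_mono[of a c T] by (auto intro: le_trans)
  have "y \<notin> ?X" using y mono by auto
  then obtain t where t: "t \<ge> a" "Suc t < c" "win t \<in> ?X" "win (Suc t) \<notin> ?X" "los (Suc t) = win t"
    using ex_switch[of x a b ?X y c] win x y by auto
  have "r a (win (Suc t)) \<le> r (Suc t) (win (Suc t))"
    using t(1) by (intro return_time_mono) simp
  also have "\<dots> \<le> r (Suc (Suc t)) (win t)"
    using t(5) by (simp del: return_time.simps(2) add: return_time.simps(2)[of _ "Suc t"])
  also have "\<dots> \<le> r c (win t)" using t(2) by (intro return_time_mono) simp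
  also have "\<dots> \<le> q" using t(3) by simp
  finally show ?thesis using t(4) mono by auto
qed

lemma winners_full_window_relpow:
  assumes "(a, b) \<in> full_window W ^^ k"
  shows "winners T a b \<subseteq> W"
  using assms
proof (induction k arbitrary: b)
  case (Suc k)
  then obtain c where c: "(a, c) \<in> full_window W ^^ k" "c \<le> b" "winners T c b = W"
    by (auto simp: full_window_def)
  then show ?case
    using Suc.IH[OF c(1)] winners_Un[OF full_window_relpow_le[OF c(1)] c(2)] by auto
qed auto

text \<open>In the last \<open>Suc (2 * CARD('a))\<close> windows a letter outside \<open>W\<close>
  loses to a letter of \<open>W\<close>, which is therefore low before them. The earlier
  \<open>2 * CARD('a)\<close> windows spread this through \<open>W\<close>, one letter per
  pair.\<close>

lemma low_everywhere:
  assumes ac: "(a, c) \<in> full_window W ^^ (2 * CARD('a) + Suc (2 * CARD('a)))"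
    and W: "W \<noteq> {}" "W \<noteq> UNIV" and low: "\<And>x. x \<notin> W \<Longrightarrow> r c x \<le> q"
  shows "r a \<alpha> \<le> q"
proof -
  obtain b where b: "(a, b) \<in> full_window W ^^ (2 * CARD('a))"
    "(b, c) \<in> full_window W ^^ Suc (2 * CARD('a))"
    using ac unfolding relpow_add by blast
  obtain t where t: "b \<le> t" "t < c" "los t \<notin> W" using ex_loser_notin[OF b(2) W] by blast
  let ?w = "win t"
  have w: "?w \<in> W"
    using winners_full_window_relpow[OF b(2)] t by (auto simp: winners_def)
  have "r b ?w \<le> r t ?w" using t(1) by (rule return_time_mono)
  also have "\<dots> \<le> r (Suc t) (los t)" by simp
  also have "\<dots> \<le> r c (los t)" using t(2) by (intro return_time_mono) simp
  also have "\<dots> \<le> q" using low t(3) .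
  finally have rw: "r b ?w \<le> q" .
  have low_b: "r b x \<le> q" if "x \<notin> W" for x
    using low[OF that] return_time_mono full_window_relpow_le[OF b(2)] le_trans by blast
  have "min CARD('a) (Suc k) \<le> card {\<beta>. r a \<beta> \<le> q}"
    if "(a, b) \<in> full_window W ^^ (2 * k)" for k a
    using that
  proof (induction k arbitrary: a)
    case 0
    then have "{\<beta>. r a \<beta> \<le> q} \<noteq> {}" using rw by auto
    then show ?case by (simp add: Suc_le_eq card_gt_0_iff)
  next
    case (Suc k)
    then have "(a, b) \<in> full_window W ^^ Suc (Suc (2 * k))" by simp
    then obtain d e where de: "(a, d) \<in> full_window W" "(d, e) \<in> full_window W"
      "(e, b) \<in> full_window W ^^ (2 * k)"
      by (meson relpow_Suc_D2)
    have eb: "e \<le> b" using full_window_relpow_le[OF de(3)] .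
    have ab: "a \<le> b" using eb de by (auto simp: full_window_def)
    show ?case
    proof (cases "{\<beta>. r a \<beta> \<le> q} = UNIV")
      case False
      then obtain y where y: "\<not> r a y \<le> q" by auto
      then have "y \<in> W" using low_b return_time_mono[OF ab] le_trans by blast
      moreover have "r e ?w \<le> q" using rw return_time_mono[OF eb] le_trans by blast
      ultimately have "card {\<beta>. r e \<beta> \<le> q} < card {\<beta>. r a \<beta> \<le> q}"
        using more_low[of a d W e ?w q y] de(1,2) w y
        by (intro psubset_card_mono) (auto simp: full_window_def)
      then show ?thesis using Suc.IH[OF de(3)] by simp
    qed simp
  qed
  from this[OF b(1)] have "{\<beta>. r a \<beta> \<le> q} = UNIV"
    by (intro card_seteq) simp_all
  then show ?thesis by auto
qed

subsection \<open>Subpolynomial growth\<close>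

text \<open>The bound is attached to a set of pairs of times because such sets can be united,
  composed and raised to a fixed power; this is how long windows are cut into pieces.\<close>

definition subpoly :: "nat rel \<Rightarrow> bool" where
  "subpoly P \<longleftrightarrow> (\<forall>\<epsilon>>0. \<exists>C>0. \<forall>(s, n)\<in>P. real (N n) \<le> C * real (N s) powr (1 + \<epsilon>))"

lemma subpoly_mono: "subpoly P \<Longrightarrow> P' \<subseteq> P \<Longrightarrow> subpoly P'"
  unfolding subpoly_def by (meson subset_iff)

lemma subpolyD:
  assumes "subpoly P" "\<epsilon> > 0"
  obtains C where "C > 0" "\<And>s n. (s, n) \<in> P \<Longrightarrow> real (N n) \<le> C * real (N s) powr (1 + \<epsilon>)"
  using assms unfolding subpoly_def by blast

lemma N_ge_1: "real (N n) \<ge> 1"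
  using N_pos[of n] by simp

lemma subpoly_linear:
  assumes "\<And>s n. (s, n) \<in> P \<Longrightarrow> real (N n) \<le> c * real (N s)" "c > 0"
  shows "subpoly P"
  unfolding subpoly_def
proof (intro allI impI exI[of _ c] conjI ballI, safe)
  fix \<epsilon> :: real and s n assume "\<epsilon> > 0" "(s, n) \<in> P"
  have "real (N s) powr 1 \<le> real (N s) powr (1 + \<epsilon>)"
    using N_ge_1 \<open>\<epsilon> > 0\<close> by (intro powr_mono) auto
  then have "c * real (N s) \<le> c * real (N s) powr (1 + \<epsilon>)"
    using N_ge_1[of s] assms(2) by simp
  with assms(1)[OF \<open>(s, n) \<in> P\<close>] show "real (N n) \<le> c * real (N s) powr (1 + \<epsilon>)" by simp
qed (use assms(2) in simp)

lemma subpoly_Id: "subpoly Id"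
  by (rule subpoly_linear[of _ 1]) auto

lemma subpoly_step: "subpoly {(n, Suc n) | n. True}"
proof (rule subpoly_linear[of _ 2])
  fix s n assume "(s, n) \<in> {(n, Suc n) | n. True}"
  then show "real (N n) \<le> 2 * real (N s)"
    using N_Suc_le[of s] by (auto simp flip: of_nat_mult)
qed simp

lemma subpoly_Un:
  assumes "subpoly P" "subpoly P'"
  shows "subpoly (P \<union> P')"
  unfolding subpoly_def
proof (intro allI impI)
  fix \<epsilon> :: real assume \<epsilon>: "\<epsilon> > 0"
  obtain C where C: "C > 0" "\<And>s n. (s, n) \<in> P \<Longrightarrow> real (N n) \<le> C * real (N s) powr (1 + \<epsilon>)"
    using subpolyD[OF assms(1) \<epsilon>] by blast
  obtain C' where C': "C' > 0" "\<And>s n. (s, n) \<in> P' \<Longrightarrow> real (N n) \<le> C' * real (N s) powr (1 + \<epsilon>)"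
    using subpolyD[OF assms(2) \<epsilon>] by blast
  have "real (N n) \<le> (C + C') * real (N s) powr (1 + \<epsilon>)" if "(s, n) \<in> P \<union> P'" for s n
  proof -
    have "0 \<le> C * real (N s) powr (1 + \<epsilon>)" "0 \<le> C' * real (N s) powr (1 + \<epsilon>)"
      using C(1) C'(1) by simp_all
    then show ?thesis using that C(2)[of s n] C'(2)[of s n] by (auto simp: distrib_right)
  qed
  then show "\<exists>C>0. \<forall>(s, n)\<in>P \<union> P'. real (N n) \<le> C * real (N s) powr (1 + \<epsilon>)"
    using C(1) C'(1) by (intro exI[of _ "C + C'"]) auto
qed

lemma subpoly_relcomp:
  assumes "subpoly P" "subpoly P'"
  shows "subpoly (P O P')"
  unfolding subpoly_def
proof (intro allI impI)
  fix \<epsilon> :: real assume "\<epsilon> > 0"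
  \<comment> \<open>Composition squares the exponent \<open>1 + \<delta>\<close>;
    \<open>\<delta> \<le> 1\<close> and \<open>3 * \<delta> \<le> \<epsilon>\<close> keep the result
    at most \<open>1 + \<epsilon>\<close>.\<close>
  define \<delta> where "\<delta> = min 1 (\<epsilon> / 3)"
  have \<delta>: "\<delta> > 0" "\<delta> * \<delta> \<le> \<delta>" "3 * \<delta> \<le> \<epsilon>"
    using \<open>\<epsilon> > 0\<close> mult_right_le_one_le[of \<delta> \<delta>] by (auto simp: \<delta>_def)
  have "(1 + \<delta>) * (1 + \<delta>) = 1 + 2 * \<delta> + \<delta> * \<delta>" by (simp add: algebra_simps)
  then have exp_le: "(1 + \<delta>) * (1 + \<delta>) \<le> 1 + \<epsilon>" using \<delta>(2,3) by linarith
  obtain C where C: "C > 0" "\<And>s n. (s, n) \<in> P \<Longrightarrow> real (N n) \<le> C * real (N s) powr (1 + \<delta>)"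
    using subpolyD[OF assms(1) \<delta>(1)] by blast
  obtain C' where C': "C' > 0" "\<And>s n. (s, n) \<in> P' \<Longrightarrow> real (N n) \<le> C' * real (N s) powr (1 + \<delta>)"
    using subpolyD[OF assms(2) \<delta>(1)] by blast
  have "real (N n) \<le> (C' * C powr (1 + \<delta>)) * real (N s) powr (1 + \<epsilon>)"
    if sm: "(s, m) \<in> P" and mn: "(m, n) \<in> P'" for s m n
  proof -
    have "real (N m) powr (1 + \<delta>) \<le> (C * real (N s) powr (1 + \<delta>)) powr (1 + \<delta>)"
      using C(2)[OF sm] \<delta>(1) by (intro powr_mono2) auto
    also have "\<dots> = C powr (1 + \<delta>) * real (N s) powr ((1 + \<delta>) * (1 + \<delta>))"
      using C(1) by (simp add: powr_mult powr_powr)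
    also have "\<dots> \<le> C powr (1 + \<delta>) * real (N s) powr (1 + \<epsilon>)"
      using exp_le N_ge_1[of s] by (intro mult_left_mono powr_mono) auto
    finally have "C' * real (N m) powr (1 + \<delta>) \<le> C' * (C powr (1 + \<delta>) * real (N s) powr (1 + \<epsilon>))"
      using C'(1) by simp
    with C'(2)[OF mn] show ?thesis by (simp add: mult.assoc)
  qed
  then show "\<exists>C>0. \<forall>(s, n)\<in>P O P'. real (N n) \<le> C * real (N s) powr (1 + \<epsilon>)"
    using C(1) C'(1) by (intro exI[of _ "C' * C powr (1 + \<delta>)"]) auto
qed

lemma subpoly_relpow:
  assumes "subpoly P"
  shows "subpoly (P ^^ k)"
  by (induction k) (simp_all add: subpoly_Id subpoly_relcomp assms)

lemma len_unchanged:
  assumes "s \<le> n" "\<gamma> \<notin> winners T s n"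
  shows "len (S n) \<gamma> = len (S s) \<gamma>"
  using assms by (induction rule: dec_induct) (auto simp: winners_Suc len_Suc)

text \<open>Condition (D) at \<open>2 * N s\<close> bounds the length of \<open>\<gamma>\<close>
  from below at time \<open>s\<close>. At time \<open>n\<close> the length is the same, and
  \<open>len_return_time_le\<close> turns it into an upper bound for
  \<open>r n \<gamma>\<close>.\<close>

lemma subpoly_unchanged:
  assumes "condition_D T"
  shows "subpoly {(s, t). \<exists>n \<gamma>. s \<le> n \<and> \<gamma> \<notin> winners T s n \<and> N t \<le> CARD('a) * r n \<gamma>}"
  unfolding subpoly_def
proof (intro allI impI)
  fix \<epsilon> :: real assume \<epsilon>: "\<epsilon> > 0"
  then obtain C where C: "C > 0" "\<And>n. n \<ge> 1 \<Longrightarrow> min_spacing T n \<ge> C * real n powr (- (1 + \<epsilon>))"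
    using assms unfolding condition_D_def by blast
  let ?d = "real CARD('a)"
  let ?C = "?d * 2 powr (1 + \<epsilon>) / C"
  have "real (N t) \<le> ?C * real (N s) powr (1 + \<epsilon>)"
    if "s \<le> n" "\<gamma> \<notin> winners T s n" "N t \<le> CARD('a) * r n \<gamma>" for s t n \<gamma>
  proof -
    let ?p = "real (2 * N s) powr (1 + \<epsilon>)"
    have "C / ?p = C * real (2 * N s) powr (- (1 + \<epsilon>))"
      by (subst powr_minus) (simp add: divide_inverse)
    also have "\<dots> \<le> len (S n) \<gamma>"
      using C(2)[of "2 * N s"] min_spacing_le_len[of s \<gamma>] len_unchanged[OF that(1,2)] N_pos[of s] by simp
    finally have "C / ?p * r n \<gamma> \<le> len (S n) \<gamma> * r n \<gamma>" by (intro mult_right_mono) auto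
    also have "\<dots> \<le> 1" by (rule len_return_time_le)
    finally have "C / ?p * r n \<gamma> \<le> 1" .
    moreover have "?p > 0" using N_pos[of s] by simp
    ultimately have "real (r n \<gamma>) \<le> ?p / C" using C(1) by (simp add: field_simps)
    then have "?d * real (r n \<gamma>) \<le> ?d * (?p / C)" by (intro mult_left_mono) auto
    moreover have "real (N t) \<le> ?d * real (r n \<gamma>)"
      using that(3) by (simp flip: of_nat_mult)
    moreover have "?p = 2 powr (1 + \<epsilon>) * real (N s) powr (1 + \<epsilon>)" by (simp add: powr_mult)
    ultimately show ?thesis by simp
  qed
  then show "\<exists>C>0. \<forall>(s, t)\<in>{(s, t). \<exists>n \<gamma>. s \<le> n \<and> \<gamma> \<notin> winners T s n \<and> N t \<le> CARD('a) * r n \<gamma>}.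
      real (N t) \<le> C * real (N s) powr (1 + \<epsilon>)"
    using C(1) by (intro exI[of _ ?C]) auto
qed

section \<open>Induction on the number of winners\<close>

definition few_winners :: "nat \<Rightarrow> nat rel" where
  "few_winners j = {(s, n). s \<le> n \<and> card (winners T s n) \<le> j}"

text \<open>Shortest full windows of \<open>W\<close> are cut off backwards from \<open>n\<close>.
  Each is one step followed by a window with fewer winners, hence a pair in \<open>U\<close>. Once
  the rest from \<open>s\<close> has fewer winners, it is a pair in \<open>U\<close> too, and
  \<open>Id \<subseteq> U\<close> fills up the power.\<close>

lemma full_window_chain:
  assumes W: "card W = Suc j" and sn: "s \<le> n" "winners T s n \<subseteq> W"
    and U: "few_winners j \<union> {(n, Suc n) | n. True} O few_winners j \<union> Id \<subseteq> U"
  shows "(s, n) \<in> U ^^ k \<or> (\<exists>t\<ge>s. (t, n) \<in> (full_window W \<inter> U) ^^ k)"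
proof (induction k)
  case 0
  then show ?case using sn by auto
next
  case (Suc k)
  then consider "(s, n) \<in> U ^^ k" | t where "t \<ge> s" "(t, n) \<in> (full_window W \<inter> U) ^^ k" by blast
  then show ?case
  proof cases
    case 1
    then show ?thesis using U by (blast intro: relpow_Suc_I2)
  next
    case 2
    note pow_mono = relpow_Int_subset[of k "full_window W" U]
    have few: "(a, b) \<in> few_winners j" if "a \<le> b" "winners T a b \<subset> W" for a b
      using that psubset_card_mono[of W "winners T a b"] W by (simp add: few_winners_def)
    have tn: "t \<le> n" using 2(2) pow_mono full_window_relpow_le by blast
    then have sub: "winners T s t \<subseteq> W" using sn(2) winners_mono[of s s t n] by blast
    show ?thesis
    proof (cases "winners T s t = W")
      case False
      then have "(s, t) \<in> U" using few[OF 2(1)] sub U by blast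
      then show ?thesis using 2(2) pow_mono by (blast intro: relpow_Suc_I2)
    next
      case True
      let ?P = "\<lambda>u. u \<le> t \<and> winners T u t = W"
      \<comment> \<open>The latest start: without step \<open>u\<close> some letter of
        \<open>W\<close> is missing.\<close>
      define u where "u = Greatest ?P"
      have u: "?P u" unfolding u_def using True 2(1) GreatestI_nat[of ?P s t] by blast
      have su: "s \<le> u" unfolding u_def using True 2(1) Greatest_le_nat[of ?P s t] by blast
      have "u \<noteq> t" using u W by auto
      then have "Suc u \<le> t" using u by simp
      moreover have "winners T (Suc u) t \<noteq> W"
        using Greatest_le_nat[of ?P "Suc u" t] \<open>Suc u \<le> t\<close> unfolding u_def by auto
      moreover have "winners T (Suc u) t \<subseteq> W" using u winners_mono[of u "Suc u" t t] by auto
      ultimately have "(Suc u, t) \<in> few_winners j" using few by blast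
      then have "(u, t) \<in> full_window W \<inter> U" using U u by (auto simp: full_window_def)
      then show ?thesis using 2(2) su by (blast intro: relpow_Suc_I2)
    qed
  qed
qed

text \<open>Either the window splits into boundedly many pieces with fewer winners, or it ends with
  \<open>?k\<close> full windows of \<open>W\<close> starting at some \<open>t\<close>. Then
  \<open>subpoly_unchanged\<close> leads from \<open>s\<close> to \<open>t\<close>, and the pieces
  lead from \<open>t\<close> to \<open>n\<close>.\<close>

lemma subpoly_few_winners:
  assumes D: "condition_D T" and "j < CARD('a)"
  shows "subpoly (few_winners j)"
  using assms(2)
proof (induction j)
  case 0
  have "few_winners 0 \<subseteq> Id"
    by (auto simp: few_winners_def winners_def)
  then show ?case using subpoly_Id subpoly_mono by blast
next
  case (Suc j)
  let ?U = "few_winners j \<union> {(n, Suc n) | n. True} O few_winners j \<union> Id"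
  let ?E = "{(s, t). \<exists>n \<gamma>. s \<le> n \<and> \<gamma> \<notin> winners T s n \<and> N t \<le> CARD('a) * r n \<gamma>}"
  let ?k = "2 * CARD('a) + Suc (2 * CARD('a))"
  have IH: "subpoly (few_winners j)" using Suc by simp
  have U: "subpoly (?U ^^ ?k)"
    by (intro subpoly_relpow subpoly_Un subpoly_relcomp IH subpoly_step subpoly_Id)
  have "few_winners (Suc j) \<subseteq> few_winners j \<union> ?U ^^ ?k \<union> ?E O (?U ^^ ?k)"
  proof safe
    fix s n assume few: "(s, n) \<in> few_winners (Suc j)" and not_E: "(s, n) \<notin> ?E O (?U ^^ ?k)"
      and not_U: "(s, n) \<notin> ?U ^^ ?k"
    show "(s, n) \<in> few_winners j"
    proof (rule ccontr)
      assume "(s, n) \<notin> few_winners j"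
      define W where "W = winners T s n"
      have W: "card W = Suc j" "s \<le> n"
        using few \<open>(s, n) \<notin> few_winners j\<close> by (auto simp: few_winners_def W_def)
      then have W': "W \<noteq> {}" "W \<noteq> UNIV" using Suc.prems by auto
      obtain t where t: "t \<ge> s" "(t, n) \<in> (full_window W \<inter> ?U) ^^ ?k"
        using full_window_chain[OF W, of ?U ?k] not_U by (auto simp: W_def)
      have tn: "(t, n) \<in> full_window W ^^ ?k" "(t, n) \<in> ?U ^^ ?k"
        using t(2) relpow_Int_subset[of ?k "full_window W" ?U] by blast+
      \<comment> \<open>Maximality makes \<open>r n \<gamma>\<close> a threshold \<open>q\<close>
        for all letters outside \<open>W\<close>, as \<open>low_everywhere\<close> requires.\<close>
      have "Max (r n ` (- W)) \<in> r n ` (- W)" using W' by (intro Max_in) auto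
      then obtain \<gamma> where \<gamma>: "\<gamma> \<notin> W" "r n \<gamma> = Max (r n ` (- W))" by auto
      have "r t \<alpha> \<le> r n \<gamma>" for \<alpha>
        using W' \<gamma> by (intro low_everywhere[OF tn(1)]) auto
      then have "N t \<le> CARD('a) * r n \<gamma>"
        unfolding N_def using sum_bounded_above[of UNIV "r t" "r n \<gamma>"] by simp
      then have "(s, t) \<in> ?E" using W(2) \<gamma>(1) by (auto simp: W_def)
      then show False using tn(2) not_E by blast
    qed
  qed
  moreover have "subpoly (few_winners j \<union> ?U ^^ ?k \<union> ?E O (?U ^^ ?k))"
    by (intro subpoly_Un subpoly_relcomp IH U subpoly_unchanged[OF D])
  ultimately show ?case by (rule subpoly_mono[rotated])
qed

end

subsection \<open>Matrices\<close>

lemma step_matrix_mult_return_time: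
  "step_matrix (rv_iter T n) *v (\<chi> j. real (return_time T n j)) = (\<chi> i. real (return_time T (Suc n) i))"
proof -
  let ?l = "loser (rv_iter T n)" and ?w = "winner (rv_iter T n)"
  have "(\<Sum>j\<in>UNIV. (if i = ?l \<and> j = ?w then 1 else 0) * real (return_time T n j)) =
      (if i = ?l then real (return_time T n ?w) else 0)" for i
    by (cases "i = ?l") (simp_all add: if_distrib[of "\<lambda>x. x * _"] cong: if_cong)
  then show ?thesis
    by (simp add: step_matrix_def matrix_vector_mult_add_rdistrib vec_eq_iff)
      (simp add: matrix_vector_mult_def)
qed

lemma rv_matrix_self: "rv_matrix T m m = mat 1"
  by (cases m) simp_all

text \<open>This links matrices and return times: as all return times are 1 at time 0, the entries
  of \<open>Q(n)\<close> sum to \<open>N n\<close>.\<close>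

lemma rv_matrix_mult_return_time:
  assumes "m \<le> n"
  shows "rv_matrix T m n *v (\<chi> j. real (return_time T m j)) = (\<chi> i. real (return_time T n i))"
  using assms
proof (induction rule: dec_induct)
  case (step n)
  then show ?case
    by (simp add: matrix_vector_mul_assoc[symmetric] step_matrix_mult_return_time del: return_time.simps)
qed (simp add: rv_matrix_self)

lemma rv_matrix_nonneg: "rv_matrix T m n $ i $ j \<ge> 0"
proof (induction n arbitrary: i j)
  case (Suc n)
  have "step_matrix (rv_iter T n) $ i $ j \<ge> 0" for i j
    by (simp add: step_matrix_def mat_def)
  then show ?case
    using Suc by (auto simp: matrix_matrix_mult_def mat_def intro!: sum_nonneg)
qed (simp add: mat_def)

context keane_orbit
begin

lemma rv_matrix_sum:
  assumes "m \<le> n"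
  shows "(\<Sum>i\<in>UNIV. \<Sum>j\<in>UNIV. rv_matrix T m n $ i $ j * r m j) = N n"
  using rv_matrix_mult_return_time[OF assms, of T]
  by (simp add: N_def vec_eq_iff matrix_vector_mult_def)

lemma matrix_norm1_rv_matrix: "matrix_norm1 (rv_matrix T 0 n) = N n"
  using rv_matrix_sum[of 0 n] by (simp add: matrix_norm1_def rv_matrix_nonneg)

lemma matrix_norm1_rv_matrix_le:
  assumes "m \<le> n" "\<And>j. c \<le> real (r m j)"
  shows "matrix_norm1 (rv_matrix T m n) * c \<le> N n"
  unfolding rv_matrix_sum[OF assms(1), symmetric] matrix_norm1_def sum_distrib_right
  using assms(2) by (intro sum_mono) (simp add: rv_matrix_nonneg mult_left_mono)

section \<open>Accelerated steps and the comparison of the two conditions\<close>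

lemma mmy_time_few_winners:
  "(mmy_time T k, mmy_time T (k + i)) \<in> few_winners (CARD('a) - 1) ^^ i"
proof (induction i)
  case (Suc i)
  have "card (winners T (mmy_time T (k + i)) (mmy_time T (Suc (k + i)))) < CARD('a)"
    using winners_mmy_time by (intro psubset_card_mono) auto
  then have "(mmy_time T (k + i), mmy_time T (k + Suc i)) \<in> few_winners (CARD('a) - 1)"
    using mmy_time_less[of "k + i"] by (simp add: few_winners_def del: mmy_time.simps)
  then show ?case using Suc by (auto simp del: mmy_time.simps)
qed simp

text \<open>An accelerated step misses some letter, but the next elementary step completes the set
  of winners and belongs to the following accelerated step. So two accelerated steps yield one full
  window.\<close>

lemma mmy_time_full_window:
  "(mmy_time T k, mmy_time T (k + 2 * i)) \<in> full_window UNIV ^^ i"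
proof (induction i)
  case (Suc i)
  let ?k = "k + 2 * i"
  have less: "mmy_time T ?k < mmy_time T (Suc ?k)" "mmy_time T (Suc ?k) < mmy_time T (Suc (Suc ?k))"
    by (rule mmy_time_less)+
  have "winners T (mmy_time T ?k) (Suc (mmy_time T (Suc ?k))) \<subseteq>
      winners T (mmy_time T ?k) (mmy_time T (Suc (Suc ?k)))"
    using less by (intro winners_mono) auto
  then have "(mmy_time T ?k, mmy_time T (Suc (Suc ?k))) \<in> full_window UNIV"
    using less winners_Suc_mmy_time[of ?k] by (auto simp: full_window_def simp del: mmy_time.simps)
  then show ?case using Suc by (auto simp del: mmy_time.simps)
qed simp

lemma condition_D_imp_A:
  assumes D: "condition_D T"
  shows "condition_A T"
  unfolding condition_A_def
proof (intro allI impI)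
  fix \<epsilon> :: real assume \<epsilon>: "\<epsilon> > 0"
  let ?M = "mmy_time T" and ?d = "real CARD('a)"
  \<comment> \<open>\<open>large_everywhere\<close> needs \<open>2 * CARD('a)\<close> full windows,
    each made of two accelerated steps.\<close>
  define K where "K = 2 * (2 * CARD('a))"
  have "CARD('a) - 1 < CARD('a)" using two by simp
  then have "subpoly (few_winners (CARD('a) - 1) ^^ Suc K)"
    by (intro subpoly_relpow subpoly_few_winners[OF D])
  from subpolyD[OF this \<epsilon>] obtain C where C: "C > 0"
    "\<And>s n. (s, n) \<in> few_winners (CARD('a) - 1) ^^ Suc K \<Longrightarrow> real (N n) \<le> C * real (N s) powr (1 + \<epsilon>)"
    by blast
  let ?a = "\<lambda>k. matrix_norm1 (mmy_matrix T k (k + 1))"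
  \<comment> \<open>The sum absorbs the indices \<open>k < K\<close>, for which one cannot go back
    \<open>K\<close> accelerated steps.\<close>
  define C' where "C' = ?d * C + (\<Sum>k<K. ?a k)"
  have a_nonneg: "?a k \<ge> 0" for k by (simp add: matrix_norm1_def sum_nonneg)
  have norm0: "matrix_norm1 (mmy_matrix T 0 k) = N (?M k)" for k
    by (simp add: mmy_matrix_def matrix_norm1_rv_matrix)
  have "?a k \<le> C' * matrix_norm1 (mmy_matrix T 0 k) powr \<epsilon>" for k
  proof (cases "k < K")
    case True
    then have "?a k \<le> (\<Sum>k<K. ?a k)" using a_nonneg by (intro member_le_sum) auto
    then have "?a k \<le> C'" using C(1) by (simp add: C'_def add_increasing)
    moreover have "1 \<le> real (N (?M k)) powr \<epsilon>" using N_ge_1 \<epsilon> by (intro ge_one_powr_ge_zero) auto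
    moreover have "C' \<ge> 0" using calculation(1) a_nonneg[of k] by linarith
    ultimately show ?thesis unfolding norm0 using mult_left_mono[of 1 "real (N (?M k)) powr \<epsilon>" C'] by simp
  next
    case False
    define l where "l = k - K"
    have k: "k = l + K" using False by (simp add: l_def)
    have "r (?M l) \<alpha> \<le> r (?M k) \<beta>" for \<alpha> \<beta>
      using mmy_time_full_window[of l "2 * CARD('a)"] unfolding k K_def by (rule large_everywhere)
    then have "N (?M l) \<le> CARD('a) * r (?M k) \<beta>" for \<beta>
      unfolding N_def using sum_bounded_above[of UNIV "r (?M l)" "r (?M k) \<beta>"] by simp
    then have "real (N (?M l)) / ?d \<le> real (r (?M k) \<beta>)" for \<beta>
      by (simp add: divide_le_eq mult.commute flip: of_nat_mult)
    \<comment> \<open>All return times at \<open>?M k\<close> are at least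
      \<open>N (?M l) / ?d\<close>, so \<open>N (?M (k + 1))\<close> controls the norm;
      \<open>Suc K\<close> accelerated steps lead from \<open>?M l\<close> to
      \<open>?M (k + 1)\<close>.\<close>
    then have "?a k * (real (N (?M l)) / ?d) \<le> N (?M (k + 1))"
      unfolding mmy_matrix_def using mmy_time_less[of k]
      by (intro matrix_norm1_rv_matrix_le) auto
    also have "\<dots> \<le> C * real (N (?M l)) powr (1 + \<epsilon>)"
      using C(2)[OF mmy_time_few_winners[of l "Suc K"]] by (simp add: k del: mmy_time.simps)
    \<comment> \<open>One factor \<open>N (?M l)\<close> is split off to cancel against the left
      side, which leaves the exponent \<open>\<epsilon>\<close>.\<close>
    also have "\<dots> = C * real (N (?M l)) powr \<epsilon> * real (N (?M l))"
      using N_pos[of "?M l"] by (simp add: powr_add)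
    finally have "?a k * real (N (?M l)) \<le> ?d * C * real (N (?M l)) powr \<epsilon> * real (N (?M l))"
      using two by (simp add: field_simps)
    then have "?a k \<le> ?d * C * real (N (?M l)) powr \<epsilon>"
      using N_pos[of "?M l"] by simp
    also have "\<dots> \<le> C' * real (N (?M k)) powr \<epsilon>"
    proof (intro mult_mono powr_mono2)
      have "?M l \<le> ?M k"
        using full_window_relpow_le[OF mmy_time_full_window[of l "2 * CARD('a)"]] by (simp add: k K_def)
      then show "real (N (?M l)) \<le> real (N (?M k))" using N_mono by simp
      show "?d * C \<le> C'" using a_nonneg by (simp add: C'_def sum_nonneg)
      then show "0 \<le> C'" using C(1) by (simp add: order_trans[of 0 "?d * C"])
    qed (use \<epsilon> in auto)
    finally show ?thesis unfolding norm0 .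
  qed
  moreover have "C' > 0"
    using two C(1) a_nonneg by (simp add: C'_def sum_nonneg add_pos_nonneg)
  ultimately show "\<exists>C>0. \<forall>k\<ge>1. ?a k \<le> C * matrix_norm1 (mmy_matrix T 0 k) powr \<epsilon>" by blast
qed

end

theorem theorem4p8:
  fixes T :: "'a::finite iet"
  assumes "CARD('a) \<ge> 2"
    and "iet_data T"
    and "admissible T"
    and "keane T"
    and "total_length T = 1"
    and "\<not> condition_A T"
  shows "\<not> condition_D T"
proof -
  interpret keane_orbit T using assms by unfold_locales
  show ?thesis using condition_D_imp_A assms(6) by blast
qed

end
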